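(* Let $d=2$. Suppose that (for every cell) the quadrature-point values of $u_h^n$ satisfy $\widetilde{\mathbf u}^{n,*,\mathrm{int}}\in[m,M]^L$ and $\mathbf u^{n,*,\mathrm{int}},\mathbf u^{n,*,\mathrm{ext}}\in\mathbb M$. Furthermore, suppose that (A1)–(A3) and the CFL constraint $$\max\Big\{\hat\sigma\,\big|\nabla_{\boldsymbol\xi}\cdot[\mathbf A_{K(t)}^{-1}\boldsymbol\omega(t)]\big|\,|K(t)|+\sum_{\nu=1}^3\lambda^n\ell_\nu:\ t\in[t_n,t_{n+1}]\Big\}\frac{\Delta t}{h^2}\le\frac{\pi\hat\sigma}{\tau^2\kappa^2}$$ are satisfied. Then the solution $u_h^{n+1}$ of the second order fully-discrete (TVD-RK2) ALE-DG method, revised by the bound preserving limiter, belongs to the interval $[m,M]$.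
   Context: **Moving mesh ($d=2$).** $\Omega\subseteq\mathbb R^2$ is an open convex polygon, $t_n<t_{n+1}$ are consecutive time levels in $[0,T]$, $\Delta t=t_{n+1}-t_n$. The meshes at $t_n,t_{n+1}$ are regular triangulations of $\Omega$ with the same topology (corresponding cells and vertices), cells positively oriented with respect to $K_{\rm ref}=\{\boldsymbol\xi\in\mathbb R^2:\xi_1,\xi_2\ge0,\ \xi_1+\xi_2\le1\}$. For corresponding vertices $\mathbf v_\ell^n,\mathbf v_\ell^{n+1}$ of a cell, $\mathbf v_\ell(t)=\mathbf v_\ell^n+\frac{t-t_n}{\Delta t}(\mathbf v_\ell^{n+1}-\mathbf v_\ell^n)$; $K(t)=\operatorname{int}\operatorname{conv}\{\mathbf v_1(t),\mathbf v_2(t),\mathbf v_3(t)\}$; $\mathbf A_{K(t)}=(\mathbf v_2(t)-\mathbf v_1(t),\mathbf v_3(t)-\mathbf v_1(t))$; $J_{K(t)}=\det\mathbf A_{K(t)}=2|K(t)|$; $\boldsymbol\chi_{K(t)}(\boldsymbol\xi,t)=\mathbf A_{K(t)}\boldsymbol\xi+\mathbf v_1(t)$; $\mathcal T_{(t)}$ is the set of cells. The grid velocity on $K_{\rm ref}$ is $\boldsymbol\omega(t)=\boldsymbol\omega(\boldsymbol\xi,t)=\frac{d}{dt}\boldsymbol\chi_{K(t)}(\boldsymbol\xi,t)$. A star denotes pull-back by $\boldsymbol\chi_{K(t)}$. Write $K^n=K(t_n)$, $K^{n+1}=K(t_{n+1})$ in $\mathbf A_{K^n},\mathbf A_{K^{n+1}}$,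 and $\boldsymbol\omega^n=\boldsymbol\omega(t_n)$, $\boldsymbol\omega^{n+1}=\boldsymbol\omega(t_{n+1})$. With $h_{K(t)}$ the diameter of $K(t)$, $\rho_{K(t)}$ the radius of the largest ball contained in $K(t)$, $h=\max_{t\in[0,T]}\max_{K(t)}h_{K(t)}$: (A1) $\overline\Omega=\bigcup_{K(t)\in\mathcal T_{(t)}}\overline{K(t)}$ for all $t\in[0,T]$; (A2) $J_{K(t)}>0$ for all $t$ and all cells; (A3) there are $\kappa,\tau>0$, independent of $h$, with $h_{K(t)}\le\kappa\rho_{K(t)}$ and $h\le\tau h_{K(t)}$ for all $t$ and all cells. $\mathbf n_\nu$, $\ell_\nu$ ($\nu=1,2,3$) are the outward normals and the lengths of the edges of $K_{\rm ref}$. **Flux.** The problem is $\partial_tu+\nabla\cdot\boldsymbol f(u)=0$ in $\Omega\times(0,T)$ with initial datum $u_0$, suitable boundary conditions and a suitable vector field $\boldsymbol f:\mathbb R\to\mathbb R^2$; $m=\min_\Omega u_0$, $M=\max_\Omega u_0$; $\boldsymbol g(\boldsymbol\omega,u)=\boldsymbol f(u)-\boldsymbol\omega u$. The Lax–Friedrichs flux is used: $$\widehat g(\boldsymbol\omega,u_1,u_2,\mathbf n)=\tfrac12[\lambda^nu_1+\boldsymbol g(\boldsymbol\omega,u_1)\cdot\mathbf n]-\tfrac12[\lambda^nu_2-\boldsymbol g(\boldsymbol\omega,u_2)\cdot\mathbf n],$$ $$\lambda^n=\max\{|\partial_u\boldsymbol g(\boldsymbol\omega,u)\cdot\mathbf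 n_{K(t)}|:\ u\in[m,M],\ t\in[t_n,t_{n+1}]\},$$ where $\mathbf n_{K(t)}=J_{K(t)}\mathbf A_{K(t)}^{-T}\mathbf n_{K_{\rm ref}}$ is the normal of the cell and $\mathbf n_{K_{\rm ref}}$ the reference normal. **Quadrature.** $k$ is the polynomial degree, $N$ the smallest integer with $2N-3\ge k$. $\sigma_\beta$, $\beta=1,\dots,k+1$, are the weights for $[-\frac12,\frac12]$ of the $(k+1)$-point Gauss rule (exact to degree $2k+1$), used on each edge. The quadrature rule of Zhang, Xia and Shu for triangles is exact for polynomials of degree $k$, has positive weights, and its nodes are the edge Gauss points, with weights $\sigma_\beta\hat\sigma$, $\hat\sigma=\frac{2}{3N(N-1)}$, and $L=3(N-2)(k+1)$ interior points with weights $\widetilde\sigma_\gamma$; the weights are normalized so that the rule gives cell averages. $Q_K$ is the set of these nodes in the cell $K$. For a cell, $\widetilde{\mathbf u}^{n,*,\mathrm{int}}$ is the vector of the values of $u_h^{n,*}$ at the $L$ interior nodes, and $\mathbf u^{n,*,\mathrm{int}}$, $\mathbf u^{n,*,\mathrm{ext}}$ are the vectors of the values, taken from inside and outside the cell, at the edge Gauss points (indexed by edge $\nu=1,2,3$ and $\beta=1,\dots,k+1$). $\mathbb M$ is the set of $\mathbf v=(\mathbf v_1,\mathbf v_2,\mathbf v_3)$ with $\mathbf v_\nu=(v_{\nu,1},\dots,v_{\nu,k+1})\in[m,M]^{k+1}$. **TVD-RK2 ALE-DG method.** $u_h^n$ is, on each cell, the image of a polynomial of degree at most $k$ on $K_{\rm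 ref}$. With $|K^n|=|K(t_n)|$ the stage areas are $$|K^{n,1}|=|K^n|+\Delta t\big(\nabla_{\boldsymbol\xi}\cdot[\mathbf A_{K^n}^{-1}\boldsymbol\omega^n]\big)|K^n|,$$ $$|K^{n+1}|=\tfrac12|K^n|+\tfrac12|K^{n,1}|+\tfrac{\Delta t}2\big(\nabla_{\boldsymbol\xi}\cdot[\mathbf A_{K^{n+1}}^{-1}\boldsymbol\omega^{n+1}]\big)|K^{n,1}|,$$ and $J_{K^n}=2|K^n|$, $J_{K^{n,1}}=2|K^{n,1}|$, $J_{K^{n+1}}=2|K^{n+1}|$. For a number $J$ and a time $t$ let $$\mathcal G(w^*,v^*,J,t)=\int_{K_{\rm ref}}J\mathbf A_{K(t)}^{-1}\boldsymbol g(\boldsymbol\omega(t),w^* )\cdot\nabla_{\boldsymbol\xi}v^*\,d\boldsymbol\xi-\sum_{\nu=1}^3\sum_{\beta=1}^{k+1}\sigma_\beta\ell_\nu\,\widehat g\big(\boldsymbol\omega_{\nu,\beta},w^{*,\mathrm{int}}_{\nu,\beta},w^{*,\mathrm{ext}}_{\nu,\beta},J\mathbf A_{K(t)}^{-T}\mathbf n_\nu\big)v^*_{\nu,\beta},$$ the subscript $\nu,\beta$ denoting the value at the $\beta$-th Gauss point of edge $\nu$. The stages satisfy, for all cells and all $v^*\in P^k(K_{\rm ref})$ (polynomials of degree at most $k$), with $(\cdot,\cdot)$ the $L^2(K_{\rm ref})$ inner product, $$J_{K^{n,1}}(u_h^{n,1,*},v^* )=J_{K^n}(u_h^{n,*},v^*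 )+\Delta t\,\mathcal G(u_h^{n,*},v^*,J_{K^n},t_n),$$ $$J_{K^{n+1}}(u_h^{n+1,*},v^* )=\tfrac12J_{K^n}(u_h^{n,*},v^* )+\tfrac12J_{K^{n,1}}(u_h^{n,1,*},v^* )+\tfrac{\Delta t}2\mathcal G(u_h^{n,1,*},v^*,J_{K^{n,1}},t_{n+1}).$$ **Limiter.** Each computed stage solution ($u_h^{n,1}$, then $u_h^{n+1}$) is revised: on each cell $K$, with $\overline u$ the cell average of the stage solution $u$, it is replaced by $$\widetilde u=\Theta(u-\overline u)+\overline u,\quad\Theta=\min\Big\{\Big|\frac{M-\overline u}{M_K-\overline u}\Big|,\Big|\frac{m-\overline u}{m_K-\overline u}\Big|,1\Big\},\quad M_K=\max_{Q_K}u,\ m_K=\min_{Q_K}u.$$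
   Formalization: λ^n is the maximum also over the second-stage normals J_{K^{n,1}}A_{K^{n+1}}^{-T}n_ν, as with the stated λ^n the bound can fail; the boundary condition is assumed to respect [m,M]; the conclusion is at the quadrature points Q_K, since between them the limited solution may leave [m,M]. *)

theory Defs
  imports "HOL-Analysis.Analysis"
begin

section \<open>Reference triangle\<close>

definition K_ref :: "(real^2) set" where
  "K_ref = {\<xi>. 0 \<le> \<xi>$1 \<and> 0 \<le> \<xi>$2 \<and> \<xi>$1 + \<xi>$2 \<le> 1}"

definition ref_vertex :: "3 \<Rightarrow> real^2" where
  "ref_vertex l = (if l = 1 then vector [0, 0] else if l = 2 then vector [1, 0] else vector [0, 1])"

text \<open>Edge \<open>\<nu>\<close> runs from vertex \<open>\<nu>\<close> to vertex \<open>\<nu> + 1\<close>; the addition is cyclic in the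
  type \<open>3\<close>, so edge \<open>3\<close> runs from vertex \<open>3\<close> to vertex \<open>1\<close>.\<close>

definition ref_tangent :: "3 \<Rightarrow> real^2" where
  "ref_tangent \<nu> = ref_vertex (\<nu> + 1) - ref_vertex \<nu>"

definition ref_edge :: "3 \<Rightarrow> (real^2) set" where
  "ref_edge \<nu> = closed_segment (ref_vertex \<nu>) (ref_vertex (\<nu> + 1))"

definition ref_len :: "3 \<Rightarrow> real" where
  "ref_len \<nu> = norm (ref_tangent \<nu>)"

text \<open>The vertices are numbered counterclockwise, so turning the tangent clockwise gives the
  outward unit normal.\<close>

definition ref_normal :: "3 \<Rightarrow> real^2" where
  "ref_normal \<nu> = (1 / ref_len \<nu>) *\<^sub>R vector [ref_tangent \<nu> $ 2, - (ref_tangent \<nu> $ 1)]"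

definition Pk :: "nat \<Rightarrow> (real^2 \<Rightarrow> real) set" where
  "Pk k = {q. \<exists>a :: nat \<Rightarrow> nat \<Rightarrow> real.
              \<forall>\<xi>. q \<xi> = (\<Sum>i\<le>k. \<Sum>j\<le>k - i. a i j * (\<xi>$1) ^ i * (\<xi>$2) ^ j)}"

text \<open>Since the cell maps are affine, this is the average of \<open>u\<close> over the cell for the
  pull-back \<open>q\<close> of \<open>u\<close>.\<close>

definition cell_avg :: "(real^2 \<Rightarrow> real) \<Rightarrow> real" where
  "cell_avg q = integral K_ref q / measure lebesgue K_ref"

definition grad :: "(real^2 \<Rightarrow> real) \<Rightarrow> real^2 \<Rightarrow> real^2" where
  "grad v \<xi> = (\<chi> i. frechet_derivative v (at \<xi>) (axis i 1))"

definition divergence :: "(real^2 \<Rightarrow> real^2) \<Rightarrow> real^2 \<Rightarrow> real" where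
  "divergence F \<xi> = (\<Sum>i\<in>UNIV. frechet_derivative F (at \<xi>) (axis i 1) $ i)"


section \<open>Quadrature\<close>

text \<open>Node and weight sequences are used at the indices \<open>1..k+1\<close> (Gauss) and
  \<open>1..L\<close> (interior).\<close>

record quad_rule =
  gnode :: "nat \<Rightarrow> real"
  gwt :: "nat \<Rightarrow> real"
  inode :: "nat \<Rightarrow> real^2"
  iwt :: "nat \<Rightarrow> real"

definition lobatto_N :: "nat \<Rightarrow> nat" where
  "lobatto_N k = (LEAST N. int k \<le> 2 * int N - 3)"

definition sigma_hat :: "nat \<Rightarrow> real" where
  "sigma_hat k = 2 / (3 * real (lobatto_N k) * (real (lobatto_N k) - 1))"

definition n_interior :: "nat \<Rightarrow> nat" where
  "n_interior k = 3 * (lobatto_N k - 2) * (k + 1)"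

definition edge_point :: "quad_rule \<Rightarrow> 3 \<Rightarrow> nat \<Rightarrow> real^2" where
  "edge_point Q \<nu> \<beta> = (1/2 - gnode Q \<beta>) *\<^sub>R ref_vertex \<nu> + (1/2 + gnode Q \<beta>) *\<^sub>R ref_vertex (\<nu> + 1)"

text \<open>A rule with \<open>k + 1\<close> distinct nodes that is exact to degree \<open>2k + 1\<close> is the Gauss rule.\<close>

definition gauss_rule :: "nat \<Rightarrow> quad_rule \<Rightarrow> bool" where
  "gauss_rule k Q \<longleftrightarrow>
     strict_mono_on {1..k+1} (gnode Q) \<and>
     gnode Q ` {1..k+1} \<subseteq> {-1/2<..<1/2} \<and>
     (\<forall>p :: real poly. degree p \<le> 2 * k + 1 \<longrightarrow>
        (\<Sum>\<beta>=1..k+1. gwt Q \<beta> * poly p (gnode Q \<beta>)) = integral {-1/2..1/2} (poly p))"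

definition triangle_rule :: "nat \<Rightarrow> quad_rule \<Rightarrow> bool" where
  "triangle_rule k Q \<longleftrightarrow>
     gauss_rule k Q \<and>
     (\<forall>\<beta>\<in>{1..k+1}. 0 < gwt Q \<beta>) \<and>
     (\<forall>\<gamma>\<in>{1..n_interior k}. 0 < iwt Q \<gamma> \<and> inode Q \<gamma> \<in> interior K_ref) \<and>
     (\<forall>q\<in>Pk k. cell_avg q =
        (\<Sum>\<nu>\<in>UNIV. \<Sum>\<beta>=1..k+1. gwt Q \<beta> * sigma_hat k * q (edge_point Q \<nu> \<beta>))
        + (\<Sum>\<gamma>=1..n_interior k. iwt Q \<gamma> * q (inode Q \<gamma>)))"

definition quad_nodes :: "nat \<Rightarrow> quad_rule \<Rightarrow> (real^2) set" where
  "quad_nodes k Q = {edge_point Q \<nu> \<beta> | \<nu> \<beta>. \<beta> \<in> {1..k+1}} \<union> inode Q ` {1..n_interior k}"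


section \<open>Moving mesh\<close>

text \<open>\<open>tlev S 0 < \<dots> < tlev S (nsteps S)\<close> are the time levels, \<open>pos S i v\<close> is the position of the
  mesh vertex \<open>v\<close> at level \<open>i\<close>, and \<open>vtx S c l\<close> is the \<open>l\<close>-th vertex of the cell \<open>c\<close>. The cells
  and their vertices do not depend on the level, so all levels have the same topology.\<close>

record ('v, 'c) mesh =
  cells :: "'c set"
  vtx :: "'c \<Rightarrow> 3 \<Rightarrow> 'v"
  pos :: "nat \<Rightarrow> 'v \<Rightarrow> real^2"
  tlev :: "nat \<Rightarrow> real"
  nsteps :: nat

definition open_convex_polygon :: "(real^2) set \<Rightarrow> bool" where
  "open_convex_polygon \<Omega> \<longleftrightarrow> (\<exists>P. polytope P \<and> \<Omega> = interior P \<and> \<Omega> \<noteq> {})"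

definition tri_matrix :: "(3 \<Rightarrow> real^2) \<Rightarrow> real^2^2" where
  "tri_matrix x = (\<chi> i j. if j = 1 then (x 2 - x 1)$i else (x 3 - x 1)$i)"

definition regular_triangulation :: "(real^2) set \<Rightarrow> ('v, 'c) mesh \<Rightarrow> nat \<Rightarrow> bool" where
  "regular_triangulation \<Omega> S i \<longleftrightarrow>
     finite (cells S) \<and> cells S \<noteq> {} \<and>
     closure \<Omega> = (\<Union>c\<in>cells S. convex hull (pos S i ` range (vtx S c))) \<and>
     (\<forall>c\<in>cells S. 0 < det (tri_matrix (\<lambda>l. pos S i (vtx S c l)))) \<and>
     (\<forall>c\<in>cells S. \<forall>d\<in>cells S. c \<noteq> d \<longrightarrow>
        convex hull (pos S i ` range (vtx S c)) \<inter> convex hull (pos S i ` range (vtx S d))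
        = convex hull (pos S i ` (range (vtx S c) \<inter> range (vtx S d))))"

definition moving_mesh :: "(real^2) set \<Rightarrow> real \<Rightarrow> ('v, 'c) mesh \<Rightarrow> bool" where
  "moving_mesh \<Omega> T S \<longleftrightarrow>
     tlev S 0 = 0 \<and> tlev S (nsteps S) = T \<and>
     (\<forall>i<nsteps S. tlev S i < tlev S (Suc i)) \<and>
     (\<forall>i\<le>nsteps S. regular_triangulation \<Omega> S i)"

text \<open>In the following, \<open>n\<close> selects the time slab \<open>[tlev S n, tlev S (Suc n)]\<close> and \<open>t\<close> is a time
  in it. The affine formula is not cut off at the ends of the slab, so the velocity at the two time
  levels is the one-sided limit from within the slab.\<close>

definition step :: "('v, 'c) mesh \<Rightarrow> nat \<Rightarrow> real" where
  "step S n = tlev S (Suc n) - tlev S n"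

definition slab :: "('v, 'c) mesh \<Rightarrow> nat \<Rightarrow> real set" where
  "slab S n = {tlev S n .. tlev S (Suc n)}"

definition vert :: "('v, 'c) mesh \<Rightarrow> nat \<Rightarrow> 'c \<Rightarrow> real \<Rightarrow> 3 \<Rightarrow> real^2" where
  "vert S n c t l = pos S n (vtx S c l)
     + ((t - tlev S n) / step S n) *\<^sub>R (pos S (Suc n) (vtx S c l) - pos S n (vtx S c l))"

definition K_at :: "('v, 'c) mesh \<Rightarrow> nat \<Rightarrow> 'c \<Rightarrow> real \<Rightarrow> (real^2) set" where
  "K_at S n c t = interior (convex hull {vert S n c t 1, vert S n c t 2, vert S n c t 3})"

definition A_at :: "('v, 'c) mesh \<Rightarrow> nat \<Rightarrow> 'c \<Rightarrow> real \<Rightarrow> real^2^2" where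
  "A_at S n c t = tri_matrix (vert S n c t)"

definition J_at :: "('v, 'c) mesh \<Rightarrow> nat \<Rightarrow> 'c \<Rightarrow> real \<Rightarrow> real" where
  "J_at S n c t = det (A_at S n c t)"

definition area_at :: "('v, 'c) mesh \<Rightarrow> nat \<Rightarrow> 'c \<Rightarrow> real \<Rightarrow> real" where
  "area_at S n c t = measure lebesgue (K_at S n c t)"

definition cell_map :: "('v, 'c) mesh \<Rightarrow> nat \<Rightarrow> 'c \<Rightarrow> real \<Rightarrow> real^2 \<Rightarrow> real^2" where
  "cell_map S n c t \<xi> = A_at S n c t *v \<xi> + vert S n c t 1"

definition cell_map_inv :: "('v, 'c) mesh \<Rightarrow> nat \<Rightarrow> 'c \<Rightarrow> real \<Rightarrow> real^2 \<Rightarrow> real^2" where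
  "cell_map_inv S n c t x = matrix_inv (A_at S n c t) *v (x - vert S n c t 1)"

definition velocity :: "('v, 'c) mesh \<Rightarrow> nat \<Rightarrow> 'c \<Rightarrow> real \<Rightarrow> real^2 \<Rightarrow> real^2" where
  "velocity S n c t \<xi> = vector_derivative (\<lambda>s. cell_map S n c s \<xi>) (at t)"

text \<open>The field is affine in \<open>\<xi>\<close>, so its divergence is constant and may be evaluated at \<open>0\<close>.\<close>

definition div_velocity :: "('v, 'c) mesh \<Rightarrow> nat \<Rightarrow> 'c \<Rightarrow> real \<Rightarrow> real" where
  "div_velocity S n c t = divergence (\<lambda>\<xi>. matrix_inv (A_at S n c t) *v velocity S n c t \<xi>) 0"

definition inradius :: "(real^2) set \<Rightarrow> real" where
  "inradius K = Sup {r. 0 \<le> r \<and> (\<exists>x. ball x r \<subseteq> K)}"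

definition mesh_size :: "('v, 'c) mesh \<Rightarrow> real" where
  "mesh_size S = Sup {diameter (K_at S i c t) | i c t. i < nsteps S \<and> c \<in> cells S \<and> t \<in> slab S i}"

definition A1 :: "(real^2) set \<Rightarrow> ('v, 'c) mesh \<Rightarrow> bool" where
  "A1 \<Omega> S \<longleftrightarrow> (\<forall>i<nsteps S. \<forall>t\<in>slab S i. closure \<Omega> = (\<Union>c\<in>cells S. closure (K_at S i c t)))"

definition A2 :: "('v, 'c) mesh \<Rightarrow> bool" where
  "A2 S \<longleftrightarrow> (\<forall>i<nsteps S. \<forall>t\<in>slab S i. \<forall>c\<in>cells S. 0 < J_at S i c t)"

definition A3 :: "('v, 'c) mesh \<Rightarrow> real \<Rightarrow> real \<Rightarrow> bool" where
  "A3 S \<kappa> \<tau> \<longleftrightarrow> 0 < \<kappa> \<and> 0 < \<tau> \<and>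
     (\<forall>i<nsteps S. \<forall>t\<in>slab S i. \<forall>c\<in>cells S.
        diameter (K_at S i c t) \<le> \<kappa> * inradius (K_at S i c t) \<and>
        mesh_size S \<le> \<tau> * diameter (K_at S i c t))"


section \<open>Stage areas, flux, and scheme\<close>

definition area_stage1 :: "('v, 'c) mesh \<Rightarrow> nat \<Rightarrow> 'c \<Rightarrow> real" where
  "area_stage1 S n c = area_at S n c (tlev S n)
     + step S n * div_velocity S n c (tlev S n) * area_at S n c (tlev S n)"

text \<open>This is the value produced by the time stepping; it need not be the area of the cell at the
  new time level.\<close>

definition area_stage2 :: "('v, 'c) mesh \<Rightarrow> nat \<Rightarrow> 'c \<Rightarrow> real" where
  "area_stage2 S n c = 1/2 * area_at S n c (tlev S n) + 1/2 * area_stage1 S n c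
     + step S n / 2 * div_velocity S n c (tlev S (Suc n)) * area_stage1 S n c"

text \<open>For \<open>J = J_at S n c t\<close> this is the normal of the cell at time \<open>t\<close>.\<close>

definition cell_normal :: "('v, 'c) mesh \<Rightarrow> nat \<Rightarrow> 'c \<Rightarrow> real \<Rightarrow> real \<Rightarrow> 3 \<Rightarrow> real^2" where
  "cell_normal S n c J t \<nu> = J *\<^sub>R (transpose (matrix_inv (A_at S n c t)) *v ref_normal \<nu>)"

definition ale_flux :: "(real \<Rightarrow> real^2) \<Rightarrow> real^2 \<Rightarrow> real \<Rightarrow> real^2" where
  "ale_flux f w u = f u - u *\<^sub>R w"

definition wave_speed ::
  "(real \<Rightarrow> real^2) \<Rightarrow> ('v, 'c) mesh \<Rightarrow> nat \<Rightarrow> 'c \<Rightarrow> real \<Rightarrow> real \<Rightarrow> 3 \<Rightarrow> real^2 \<Rightarrow> real \<Rightarrow> real" where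
  "wave_speed f S n c J t \<nu> \<xi> u =
     \<bar>vector_derivative (ale_flux f (velocity S n c t \<xi>)) (at u) \<bullet> cell_normal S n c J t \<nu>\<bar>"

text \<open>One value for the whole mesh. The supremum is a maximum when \<open>f\<close> is continuously
  differentiable, the mesh is finite and the Jacobians are positive. The second set contains the
  normals at which the second stage evaluates the flux: these are scaled with the stage value
  \<open>2 * area_stage1\<close>, which may exceed the Jacobian at the new time level, and then the first set
  alone does not make the flux monotone.\<close>

definition lf_lambda ::
  "(real \<Rightarrow> real^2) \<Rightarrow> ('v, 'c) mesh \<Rightarrow> nat \<Rightarrow> real \<Rightarrow> real \<Rightarrow> real" where
  "lf_lambda f S n m M = Sup
     ({wave_speed f S n c (J_at S n c t) t \<nu> \<xi> u | c t \<nu> \<xi> u.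
         c \<in> cells S \<and> t \<in> slab S n \<and> \<xi> \<in> ref_edge \<nu> \<and> u \<in> {m..M}}
      \<union> {wave_speed f S n c (2 * area_stage1 S n c) (tlev S (Suc n)) \<nu> \<xi> u | c \<nu> \<xi> u.
         c \<in> cells S \<and> \<xi> \<in> ref_edge \<nu> \<and> u \<in> {m..M}})"

definition lf_flux ::
  "(real \<Rightarrow> real^2) \<Rightarrow> real \<Rightarrow> real^2 \<Rightarrow> real \<Rightarrow> real \<Rightarrow> real^2 \<Rightarrow> real" where
  "lf_flux f lam w u1 u2 \<n> =
     1/2 * (lam * u1 + ale_flux f w u1 \<bullet> \<n>) - 1/2 * (lam * u2 - ale_flux f w u2 \<bullet> \<n>)"

text \<open>A mesh function gives, for every cell, the pull-back to \<open>K_ref\<close>. A boundary condition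
  \<open>B t q c \<nu> \<beta>\<close> gives the exterior value at the \<open>\<beta>\<close>-th Gauss point of a boundary edge from the
  time and the current mesh function.\<close>

type_synonym 'c mesh_fun = "'c \<Rightarrow> real^2 \<Rightarrow> real"
type_synonym 'c boundary_cond = "real \<Rightarrow> 'c mesh_fun \<Rightarrow> 'c \<Rightarrow> 3 \<Rightarrow> nat \<Rightarrow> real"

definition neighbour :: "('v, 'c) mesh \<Rightarrow> 'c \<Rightarrow> 3 \<Rightarrow> 'c \<Rightarrow> bool" where
  "neighbour S c \<nu> d \<longleftrightarrow> d \<in> cells S \<and> d \<noteq> c \<and> {vtx S c \<nu>, vtx S c (\<nu> + 1)} \<subseteq> range (vtx S d)"

definition interior_value :: "quad_rule \<Rightarrow> 'c mesh_fun \<Rightarrow> 'c \<Rightarrow> 3 \<Rightarrow> nat \<Rightarrow> real" where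
  "interior_value Q q c \<nu> \<beta> = q c (edge_point Q \<nu> \<beta>)"

text \<open>The neighbour is unique, because the triangulation is regular.\<close>

definition exterior_value ::
  "('v, 'c) mesh \<Rightarrow> quad_rule \<Rightarrow> 'c boundary_cond \<Rightarrow> nat \<Rightarrow> real \<Rightarrow> 'c mesh_fun \<Rightarrow> 'c \<Rightarrow> 3 \<Rightarrow> nat \<Rightarrow> real"
  where
  "exterior_value S Q B n t q c \<nu> \<beta> =
     (if \<exists>d. neighbour S c \<nu> d
      then let d = (SOME d. neighbour S c \<nu> d)
           in q d (cell_map_inv S n d t (cell_map S n c t (edge_point Q \<nu> \<beta>)))
      else B t q c \<nu> \<beta>)"

definition M_set :: "nat \<Rightarrow> real \<Rightarrow> real \<Rightarrow> (3 \<Rightarrow> nat \<Rightarrow> real) set" where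
  "M_set k m M = {v. \<forall>\<nu>. \<forall>\<beta>\<in>{1..k+1}. v \<nu> \<beta> \<in> {m..M}}"

definition nodes_within :: "('v, 'c) mesh \<Rightarrow> nat \<Rightarrow> quad_rule \<Rightarrow> real \<Rightarrow> real \<Rightarrow> 'c mesh_fun \<Rightarrow> bool" where
  "nodes_within S k Q m M q \<longleftrightarrow> (\<forall>c\<in>cells S. \<forall>\<xi>\<in>quad_nodes k Q. q c \<xi> \<in> {m..M})"

text \<open>The only property required of the boundary condition is that it respects the bounds.\<close>

definition admissible_bc ::
  "('v, 'c) mesh \<Rightarrow> nat \<Rightarrow> quad_rule \<Rightarrow> real \<Rightarrow> real \<Rightarrow> real \<Rightarrow> 'c boundary_cond \<Rightarrow> bool" where
  "admissible_bc S k Q T m M B \<longleftrightarrow>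
     (\<forall>t\<in>{0..T}. \<forall>q. (\<forall>c\<in>cells S. q c \<in> Pk k) \<and> nodes_within S k Q m M q \<longrightarrow>
        (\<forall>c\<in>cells S. \<forall>\<nu>. (\<nexists>d. neighbour S c \<nu> d) \<longrightarrow>
           (\<forall>\<beta>\<in>{1..k+1}. B t q c \<nu> \<beta> \<in> {m..M})))"

definition dg_rhs ::
  "(real \<Rightarrow> real^2) \<Rightarrow> ('v, 'c) mesh \<Rightarrow> nat \<Rightarrow> quad_rule \<Rightarrow> 'c boundary_cond \<Rightarrow> real \<Rightarrow> nat \<Rightarrow> 'c
    \<Rightarrow> 'c mesh_fun \<Rightarrow> (real^2 \<Rightarrow> real) \<Rightarrow> real \<Rightarrow> real \<Rightarrow> real" where
  "dg_rhs f S k Q B lam n c w v J t =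
     integral K_ref (\<lambda>\<xi>. (J *\<^sub>R (matrix_inv (A_at S n c t)
                            *v ale_flux f (velocity S n c t \<xi>) (w c \<xi>))) \<bullet> grad v \<xi>)
     - (\<Sum>\<nu>\<in>UNIV. \<Sum>\<beta>=1..k+1. gwt Q \<beta> * ref_len \<nu>
          * lf_flux f lam (velocity S n c t (edge_point Q \<nu> \<beta>))
              (interior_value Q w c \<nu> \<beta>) (exterior_value S Q B n t w c \<nu> \<beta>)
              (cell_normal S n c J t \<nu>)
          * v (edge_point Q \<nu> \<beta>))"

definition L2_ref :: "(real^2 \<Rightarrow> real) \<Rightarrow> (real^2 \<Rightarrow> real) \<Rightarrow> real" where
  "L2_ref p q = integral K_ref (\<lambda>\<xi>. p \<xi> * q \<xi>)"

definition rk2_stage1 ::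
  "(real \<Rightarrow> real^2) \<Rightarrow> ('v, 'c) mesh \<Rightarrow> nat \<Rightarrow> quad_rule \<Rightarrow> 'c boundary_cond \<Rightarrow> real \<Rightarrow> nat
    \<Rightarrow> 'c mesh_fun \<Rightarrow> 'c mesh_fun \<Rightarrow> bool" where
  "rk2_stage1 f S k Q B lam n u0 u1 \<longleftrightarrow>
     (\<forall>c\<in>cells S. u1 c \<in> Pk k \<and>
       (\<forall>v\<in>Pk k.
          2 * area_stage1 S n c * L2_ref (u1 c) v
          = 2 * area_at S n c (tlev S n) * L2_ref (u0 c) v
            + step S n * dg_rhs f S k Q B lam n c u0 v (2 * area_at S n c (tlev S n)) (tlev S n)))"

definition rk2_stage2 ::
  "(real \<Rightarrow> real^2) \<Rightarrow> ('v, 'c) mesh \<Rightarrow> nat \<Rightarrow> quad_rule \<Rightarrow> 'c boundary_cond \<Rightarrow> real \<Rightarrow> nat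
    \<Rightarrow> 'c mesh_fun \<Rightarrow> 'c mesh_fun \<Rightarrow> 'c mesh_fun \<Rightarrow> bool" where
  "rk2_stage2 f S k Q B lam n u0 u1 u2 \<longleftrightarrow>
     (\<forall>c\<in>cells S. u2 c \<in> Pk k \<and>
       (\<forall>v\<in>Pk k.
          2 * area_stage2 S n c * L2_ref (u2 c) v
          = 1/2 * (2 * area_at S n c (tlev S n)) * L2_ref (u0 c) v
            + 1/2 * (2 * area_stage1 S n c) * L2_ref (u1 c) v
            + step S n / 2
              * dg_rhs f S k Q B lam n c u1 v (2 * area_stage1 S n c) (tlev S (Suc n))))"


section \<open>Limiter\<close>

text \<open>A quotient with denominator \<open>0\<close> counts as infinite and drops out of the minimum with \<open>1\<close>.\<close>

definition lim_ratio :: "real \<Rightarrow> real \<Rightarrow> real" where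
  "lim_ratio a b = (if b = 0 then 1 else \<bar>a / b\<bar>)"

definition limiter :: "nat \<Rightarrow> quad_rule \<Rightarrow> real \<Rightarrow> real \<Rightarrow> (real^2 \<Rightarrow> real) \<Rightarrow> real^2 \<Rightarrow> real" where
  "limiter k Q m M u =
     (let ubar = cell_avg u;
          M_K = Max (u ` quad_nodes k Q);
          m_K = Min (u ` quad_nodes k Q);
          \<Theta> = min (lim_ratio (M - ubar) (M_K - ubar)) (min (lim_ratio (m - ubar) (m_K - ubar)) 1)
      in (\<lambda>\<xi>. \<Theta> * (u \<xi> - ubar) + ubar))"

end

theory Submission
  imports Defs
begin

text \<open>Testing the scheme with \<open>v = 1\<close> turns each stage into an update of the cell average. With the
  average expanded by the quadrature rule, this update is a monotone function of all nodal values,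
  provided \<open>\<Delta>t \<lambda> \<ell> \<le> \<sigma>_hat |K|\<close> for the area \<open>|K|\<close> on which the stage starts. It maps a constant
  \<open>C\<close> to \<open>C\<close> times the new stage area, because the flux of the affine grid velocity is integrated
  exactly (discrete geometric conservation law). So the new average lies in \<open>[m, M]\<close>, and the
  limiter carries this over to the nodes. The CFL condition supplies the bound on \<open>\<Delta>t\<close>, since
  \<open>pi h^2 / (\<tau> \<kappa>)^2 \<le> pi \<rho>^2 < |K|\<close>; the divergence term in it keeps the area of the first stage
  large enough for the second stage. In the second stage the exterior values are values at Gauss
  points of the neighbouring cell, as the Gauss nodes are symmetric.\<close>

section \<open>Quadrature\<close>

text \<open>The product has degree at most \<open>2 * k + 1\<close>, so the rule integrates it
  exactly, and its first factor vanishes at every node.\<close>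

lemma gauss_rule_orthogonal:
  assumes "gauss_rule k Q" and "degree q \<le> k"
  shows "integral {-1/2..1/2} (poly ((\<Prod>\<beta>=1..k+1. [:- gnode Q \<beta>, 1:]) * q)) = 0"
proof -
  let ?P = "\<Prod>\<beta>=1..k+1. [:- gnode Q \<beta>, 1:]"
  have "degree ?P = k + 1"
    by (subst degree_prod_eq_sum_degree) auto
  then have "degree (?P * q) \<le> 2 * k + 1"
    using assms(2) degree_mult_le[of ?P q] by linarith
  then have "integral {-1/2..1/2} (poly (?P * q))
      = (\<Sum>\<beta>=1..k+1. gwt Q \<beta> * poly (?P * q) (gnode Q \<beta>))"
    using assms(1) unfolding gauss_rule_def by presburger
  also have "\<dots> = 0"
    by (rule sum.neutral) (auto simp: poly_prod simp del: prod.cl_ivl_Suc)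
  finally show ?thesis .
qed

text \<open>The nodal polynomial of the Gauss rule is orthogonal to all lower degrees, and this
  determines it up to a factor; hence it is even or odd.\<close>

lemma gauss_rule_symmetric:
  assumes Q: "gauss_rule k Q" and \<beta>: "\<beta> \<in> {1..k+1}"
  obtains \<beta>' where "\<beta>' \<in> {1..k+1}" "gnode Q \<beta>' = - gnode Q \<beta>"
proof -
  define P where "P = (\<Prod>\<beta>=1..k+1. [:- gnode Q \<beta>, 1:])"
  \<comment> \<open>\<open>R\<close> is \<open>P\<close> reflected at the origin. The sign in
    \<open>D\<close> cancels the leading terms, so \<open>D\<close> has degree at most
    \<open>k\<close> and \<open>P\<close> is orthogonal to it.\<close>
  define R where "R = pcompose P [:0, -1:]"
  define D where "D = P - smult ((-1) ^ (k+1)) R"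
  have deg: "degree P = k + 1"
    unfolding P_def by (subst degree_prod_eq_sum_degree) auto
  have lead: "lead_coeff P = 1"
    unfolding P_def by (subst lead_coeff_prod) auto
  have degR: "degree R = k + 1"
    using deg by (simp add: R_def degree_pcompose)
  have leadR: "lead_coeff R = (-1) ^ (k+1)"
    using lead deg unfolding R_def by (subst lead_coeff_comp) auto
  have "coeff D (k+1) = 0"
    using lead leadR deg degR by (simp add: D_def flip: power_mult_distrib)
  moreover have "degree D \<le> k + 1"
    unfolding D_def using deg degR
    by (intro degree_diff_le) auto
  ultimately have degD: "degree D \<le> k"
    by (metis Suc_eq_plus1 eq_zero_or_degree_less le_less less_Suc_eq_le degree_0 le0)
  have orth: "integral {-1/2..1/2} (poly (P * q)) = 0" if "degree q \<le> k" for q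
    using gauss_rule_orthogonal[OF Q that] unfolding P_def .
  have int: "poly q integrable_on {-1/2..1/2}" for q :: "real poly"
    by (intro integrable_continuous_interval continuous_intros)
  \<comment> \<open>Reflection turns \<open>R * D\<close> into \<open>P\<close> times the reflection
    of \<open>D\<close>, whose degree is still at most \<open>k\<close>.\<close>
  have "integral {-1/2..1/2} (poly (R * D))
      = integral {-1/2..1/2} (\<lambda>x. poly (P * pcompose D [:0, -1:]) (- x))"
    by (intro integral_cong) (auto simp: R_def poly_pcompose)
  also have "\<dots> = integral {-1/2..1/2} (poly (P * pcompose D [:0, -1:]))"
    using Henstock_Kurzweil_Integration.integral_reflect_real
      [of "1/2" "-1/2" "poly (P * pcompose D [:0, -1:])"] by simp
  also have "\<dots> = 0"
    using degD by (intro orth) (simp add: degree_pcompose)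
  finally have R0: "integral {-1/2..1/2} (poly (R * D)) = 0" .
  \<comment> \<open>Expanding one factor \<open>D\<close> leaves two vanishing integrals. The square
    is continuous and nonnegative, so it vanishes on the whole interval and \<open>D\<close> has
    infinitely many roots.\<close>
  have "poly (D * D) = (\<lambda>x. poly (P * D) x - (-1) ^ (k+1) * poly (R * D) x)"
    by (auto simp: D_def algebra_simps)
  then have "integral {-1/2..1/2} (poly (D * D))
      = integral {-1/2..1/2} (poly (P * D)) - (-1) ^ (k+1) * integral {-1/2..1/2} (poly (R * D))"
    by (simp only: integral_diff int integrable_on_mult_right integral_mult_right)
  then have "integral {-1/2..1/2} (poly (D * D)) = 0"
    using orth[OF degD] R0 by simp
  then have "poly (D * D) x = 0" if "x \<in> {-1/2..1/2}" for x
    using that int[of "D * D"]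
    by (intro has_integral_0_cbox_imp_0[of "-1/2" "1/2" "poly (D * D)"])
       (auto simp: has_integral_iff intro!: continuous_intros simp flip: power2_eq_square)
  then have "{-1/2..1/2} \<subseteq> {x. poly D x = 0}"
    by auto
  moreover have "infinite {-1/2..1/2::real}"
    by (simp add: infinite_Icc)
  ultimately have "D = 0"
    using poly_roots_finite[of D] finite_subset by blast
  then have "P = smult ((-1) ^ (k+1)) R"
    unfolding D_def by simp
  then have "poly P (gnode Q \<beta>) = (-1) ^ (k+1) * poly R (gnode Q \<beta>)"
    by (metis poly_smult)
  moreover have "poly P (gnode Q \<beta>) = 0"
    using \<beta> by (auto simp: P_def poly_prod simp del: prod.cl_ivl_Suc)
  ultimately have "poly R (gnode Q \<beta>) = 0"
    by simp
  then have "poly P (- gnode Q \<beta>) = 0"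
    by (simp add: R_def poly_pcompose)
  then obtain \<beta>' where "\<beta>' \<in> {1..k+1}" "- gnode Q \<beta> - gnode Q \<beta>' = 0"
    by (auto simp: P_def poly_prod simp del: prod.cl_ivl_Suc)
  then show thesis
    by (intro that[of \<beta>']) auto
qed

text \<open>Degrees 0 and 1 are what the grid velocity calls for, as it is affine along an edge. The
  first moment vanishes by symmetry of the interval.\<close>

lemma gauss_rule_moments:
  assumes "gauss_rule k Q"
  shows "(\<Sum>\<beta>=1..k+1. gwt Q \<beta>) = 1" and "(\<Sum>\<beta>=1..k+1. gwt Q \<beta> * gnode Q \<beta>) = 0"
proof -
  have ex: "(\<Sum>\<beta>=1..k+1. gwt Q \<beta> * poly p (gnode Q \<beta>)) = integral {-1/2..1/2} (poly p)"
    if "degree p \<le> 1" for p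
    using assms that unfolding gauss_rule_def by auto
  show "(\<Sum>\<beta>=1..k+1. gwt Q \<beta>) = 1"
    using ex[of 1] by (simp add: poly_1[abs_def])
  have "integral {-1/2..1/2} (\<lambda>x::real. x) = 0"
    using ident_has_integral[of "-1/2" "1/2::real"] by (simp add: has_integral_iff)
  then show "(\<Sum>\<beta>=1..k+1. gwt Q \<beta> * gnode Q \<beta>) = 0"
    using ex[of "[:0, 1:]"] by (simp add: poly_pCons[abs_def] del: sum.cl_ivl_Suc)
qed

section \<open>Polynomials and areas on the reference triangle\<close>

lemma Pk_affine:
  assumes "q \<in> Pk k"
  shows "(\<lambda>\<xi>. a * q \<xi> + b) \<in> Pk k"
proof -
  obtain c where c: "\<And>\<xi>. q \<xi> = (\<Sum>i\<le>k. \<Sum>j\<le>k - i. c i j * (\<xi>$1) ^ i * (\<xi>$2) ^ j)"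
    using assms unfolding Pk_def by blast
  define d where "d i j = a * c i j + (if i = 0 then if j = 0 then b else 0 else 0)" for i j :: nat
  have "(\<Sum>j\<le>k - i. d i j * (\<xi>$1) ^ i * (\<xi>$2) ^ j)
      = a * (\<Sum>j\<le>k - i. c i j * (\<xi>$1) ^ i * (\<xi>$2) ^ j) + (if i = 0 then b else 0)"
    for i and \<xi> :: "real^2"
  proof -
    have "d i j * (\<xi>$1) ^ i * (\<xi>$2) ^ j = a * (c i j * (\<xi>$1) ^ i * (\<xi>$2) ^ j)
        + (if j = 0 then if i = 0 then b else 0 else 0)" for j
      by (auto simp: d_def algebra_simps)
    then show ?thesis
      by (simp add: sum.distrib sum_distrib_left)
  qed
  then have "a * q \<xi> + b = (\<Sum>i\<le>k. \<Sum>j\<le>k - i. d i j * (\<xi>$1) ^ i * (\<xi>$2) ^ j)" for \<xi>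
    by (simp add: c sum.distrib sum_distrib_left)
  then show ?thesis
    unfolding Pk_def by blast
qed

lemma const_in_Pk: "(\<lambda>_. b) \<in> Pk k"
proof -
  have "(\<lambda>_. 0) \<in> Pk k"
    unfolding Pk_def by (auto intro!: exI[of _ "\<lambda>_ _. 0"])
  from Pk_affine[OF this, of 0 b] show ?thesis by simp
qed

text \<open>The value \<open>k + 3\<close> shows that the least \<open>N\<close> exists, and it
  satisfies \<open>2 * N \<ge> k + 3\<close>. The bound makes the denominator of
  \<open>sigma_hat\<close> positive.\<close>

lemma lobatto_N_ge_2: "2 \<le> lobatto_N k"
proof -
  have "int k \<le> 2 * int (lobatto_N k) - 3"
    unfolding lobatto_N_def by (rule LeastI[of _ "k + 3"]) simp
  then show ?thesis by simp
qed

lemma sigma_hat_pos: "0 < sigma_hat k"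
  using lobatto_N_ge_2[of k] by (simp add: sigma_hat_def)

lemma UNIV_3_succ: "1 + 1 = (2::3)" "2 + 1 = (3::3)" "3 + 1 = (1::3)" "4 = (1::3)"
  by auto

lemma K_ref_eq_hull: "K_ref = convex hull {vector [0, 0], vector [1, 0], vector [0, 1]}"
proof -
  have "\<exists>u v w. 0 \<le> u \<and> 0 \<le> v \<and> 0 \<le> w \<and> u + v + w = 1 \<and>
      \<xi> = u *\<^sub>R vector [0, 0] + v *\<^sub>R vector [1, 0] + w *\<^sub>R vector [0, 1]"
    if "0 \<le> \<xi>$1" "0 \<le> \<xi>$2" "\<xi>$1 + \<xi>$2 \<le> 1" for \<xi> :: "real^2"
    \<comment> \<open>The barycentric coordinates of \<xi>.\<close>
    using that by (intro exI[of _ "1 - \<xi>$1 - \<xi>$2"] exI[of _ "\<xi>$1"] exI[of _ "\<xi>$2"])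
      (auto simp: vec_eq_iff forall_2)
  then show ?thesis
    unfolding convex_hull_3 K_ref_def by (force simp: set_eq_iff)
qed

text \<open>The triangle is closed, hence Borel, so the completed measure agrees with
  \<open>lborel\<close>, for which the area formula is known.\<close>

lemma measure_lebesgue_triangle:
  fixes A B C :: "real^2"
  shows "measure lebesgue (convex hull {A, B, C}) =
    \<bar>(C $ 1 - A $ 1) * (B $ 2 - A $ 2) - (B $ 1 - A $ 1) * (C $ 2 - A $ 2)\<bar> / 2"
proof -
  have "closed (convex hull {A, B, C})"
    by (simp add: compact_imp_closed finite_imp_compact_convex_hull)
  then have "measure lebesgue (convex hull {A, B, C}) = measure lborel (convex hull {A, B, C})"
    by (intro measure_completion) auto
  then show ?thesis
    by (simp add: content_triangle)
qed

lemma measure_K_ref: "measure lebesgue K_ref = 1/2"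
  by (simp add: K_ref_eq_hull measure_lebesgue_triangle)

lemma edge_point_in_ref_edge:
  assumes "gauss_rule k Q" "\<beta> \<in> {1..k+1}"
  shows "edge_point Q \<nu> \<beta> \<in> ref_edge \<nu>"
proof -
  have "gnode Q \<beta> \<in> {-1/2<..<1/2}"
    using assms unfolding gauss_rule_def by blast
  then show ?thesis
    unfolding ref_edge_def edge_point_def in_segment
    by (intro exI[of _ "1/2 + gnode Q \<beta>"]) auto
qed

lemma finite_quad_nodes: "finite (quad_nodes k Q)"
proof -
  have "quad_nodes k Q = (\<Union>\<nu>. edge_point Q \<nu> ` {1..k+1}) \<union> inode Q ` {1..n_interior k}"
    unfolding quad_nodes_def by blast
  then show ?thesis by simp
qed

lemma edge_point_in_quad_nodes: "\<beta> \<in> {1..k+1} \<Longrightarrow> edge_point Q \<nu> \<beta> \<in> quad_nodes k Q"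
  unfolding quad_nodes_def by blast

lemma triangle_rule_avg:
  assumes "triangle_rule k Q" "q \<in> Pk k"
  shows "cell_avg q = (\<Sum>\<nu>\<in>UNIV. \<Sum>\<beta>=1..k+1. gwt Q \<beta> * sigma_hat k * q (edge_point Q \<nu> \<beta>))
        + (\<Sum>\<gamma>=1..n_interior k. iwt Q \<gamma> * q (inode Q \<gamma>))"
  using assms unfolding triangle_rule_def by blast

lemma cell_avg_const: "cell_avg (\<lambda>_. b) = b"
proof -
  have "K_ref \<in> lmeasurable"
    unfolding K_ref_eq_hull
    by (intro measurable_convex) (auto simp: finite_imp_bounded_convex_hull)
  then have "integral K_ref (\<lambda>_. b) = b * measure lebesgue K_ref"
    using lmeasure_integral[of K_ref] integral_mult_right[of K_ref b "\<lambda>_. 1"] by simp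
  then show ?thesis
    unfolding cell_avg_def by (simp add: measure_K_ref)
qed

section \<open>The bound preserving limiter\<close>

lemma limiter_in_Pk: "q \<in> Pk k \<Longrightarrow> limiter k Q m M q \<in> Pk k"
proof -
  assume q: "q \<in> Pk k"
  obtain \<theta> where "limiter k Q m M q = (\<lambda>\<xi>. \<theta> * (q \<xi> - cell_avg q) + cell_avg q)"
    unfolding limiter_def Let_def by blast
  then have "limiter k Q m M q = (\<lambda>\<xi>. \<theta> * q \<xi> + (cell_avg q - \<theta> * cell_avg q))"
    by (auto simp: algebra_simps)
  with Pk_affine[OF q] show ?thesis by metis
qed

text \<open>The factor is at most the ratio for the extreme node value, so the extreme deviation
  from the average shrinks to at most the distance to the bound. Nodes on the same side of the
  average deviate no further.\<close>

lemma limiter_within: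
  assumes avg: "cell_avg q \<in> {m..M}" and \<xi>: "\<xi> \<in> quad_nodes k Q"
  shows "limiter k Q m M q \<xi> \<in> {m..M}"
proof -
  let ?a = "cell_avg q"
  define M' where "M' = Max (q ` quad_nodes k Q)"
  define m' where "m' = Min (q ` quad_nodes k Q)"
  define \<theta> where "\<theta> = min (lim_ratio (M - ?a) (M' - ?a)) (min (lim_ratio (m - ?a) (m' - ?a)) 1)"
  have lim: "limiter k Q m M q \<xi> = \<theta> * (q \<xi> - ?a) + ?a"
    unfolding limiter_def Let_def \<theta>_def M'_def m'_def by simp
  have le: "q \<xi> \<le> M'" "m' \<le> q \<xi>"
    unfolding M'_def m'_def using \<xi> finite_quad_nodes by auto
  have \<theta>: "0 \<le> \<theta>"
    unfolding \<theta>_def lim_ratio_def by auto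
  have "\<theta> * (q \<xi> - ?a) \<le> M - ?a"
  \<comment> \<open>A value not above the average cannot cross \<open>M\<close>. Otherwise the
    maximum exceeds the average, so the default of \<open>lim_ratio\<close> does not occur.\<close>
  proof (cases "q \<xi> \<le> ?a")
    case True
    then have "\<theta> * (q \<xi> - ?a) \<le> 0"
      using \<theta> by (simp add: mult_nonneg_nonpos)
    then show ?thesis using avg by simp
  next
    case False
    then have pos: "0 < M' - ?a" using le by simp
    have "\<theta> \<le> (M - ?a) / (M' - ?a)"
      unfolding \<theta>_def lim_ratio_def using pos avg by auto
    then have "\<theta> * (M' - ?a) \<le> M - ?a"
      using pos by (simp add: field_simps)
    moreover have "\<theta> * (q \<xi> - ?a) \<le> \<theta> * (M' - ?a)"
      using \<theta> le by (intro mult_left_mono) auto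
    ultimately show ?thesis by simp
  qed
  moreover have "m - ?a \<le> \<theta> * (q \<xi> - ?a)"
  proof (cases "?a \<le> q \<xi>")
    case True
    then have "0 \<le> \<theta> * (q \<xi> - ?a)"
      using \<theta> by simp
    then show ?thesis using avg by simp
  next
    case False
    then have neg: "m' - ?a < 0" using le by simp
    have "0 \<le> (m - ?a) / (m' - ?a)"
      using neg avg by (intro divide_nonpos_neg) auto
    then have "\<bar>(m - ?a) / (m' - ?a)\<bar> = (m - ?a) / (m' - ?a)"
      by (rule abs_of_nonneg)
    then have "\<theta> \<le> (m - ?a) / (m' - ?a)"
      unfolding \<theta>_def lim_ratio_def using neg by auto
    then have "\<theta> * (m' - ?a) \<ge> m - ?a"
      using neg by (simp add: field_simps)
    moreover have "\<theta> * (q \<xi> - ?a) \<ge> \<theta> * (m' - ?a)"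
      using \<theta> le by (intro mult_left_mono) auto
    ultimately show ?thesis by simp
  qed
  ultimately show ?thesis
    unfolding lim by simp
qed

section \<open>Geometry of a triangle\<close>

text \<open>Twice the difference is a combination of squares with nonnegative weights. The lemma
  serves to bound the product in Heron's formula.\<close>

lemma am_gm_3:
  fixes x y z :: real
  assumes "0 \<le> x" "0 \<le> y" "0 \<le> z"
  shows "27 * (x * y * z) \<le> (x + y + z) ^ 3"
proof -
  have "2 * ((x + y + z) ^ 3 - 27 * (x * y * z))
      = (x + y + z) * ((x - y)\<^sup>2 + (y - z)\<^sup>2 + (z - x)\<^sup>2)
        + 6 * (x * (y - z)\<^sup>2 + y * (z - x)\<^sup>2 + z * (x - y)\<^sup>2)"
    by (simp add: power2_eq_square power3_eq_cube algebra_simps)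
  also have "0 \<le> \<dots>"
    using assms by simp
  finally show ?thesis by simp
qed

text \<open>Twice the signed area of the triangle spanned by \<open>a\<close> and \<open>b\<close>.
  For nonzero \<open>e\<close>, \<open>cross2 e (z - p) / norm e\<close> is the signed distance of
  \<open>z\<close> from the line through \<open>p\<close> along \<open>e\<close>, positive on the
  left.\<close>

definition cross2 :: "real^2 \<Rightarrow> real^2 \<Rightarrow> real" where
  "cross2 a b = a$1 * b$2 - a$2 * b$1"

text \<open>Moving from the centre by \<open>s\<close> towards the line stays in the open ball,
  hence on the left of the line; so the centre is at least \<open>s\<close> away.\<close>

lemma cross2_ball_ge:
  assumes pos: "\<And>z. z \<in> ball y r \<Longrightarrow> 0 \<le> cross2 e (z - p)" and "0 \<le> s" "s < r"
  shows "s * norm e \<le> cross2 e (y - p)"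
proof (cases "e = 0")
  case True
  then show ?thesis by (simp add: cross2_def)
next
  case False
  \<comment> \<open>\<open>w\<close> is \<open>e\<close> turned left by a right angle, so
    subtracting a multiple of it moves perpendicularly towards the line.\<close>
  define w :: "real^2" where "w = vector [- (e$2), e$1]"
  have norms: "norm e * norm e = e$1 * e$1 + e$2 * e$2" "norm w = norm e"
    by (simp_all add: norm_vec_def L2_set_def sum_2 w_def power2_eq_square add.commute)
  define z where "z = y - (s / norm e) *\<^sub>R w"
  have "dist y z = s"
    using False \<open>0 \<le> s\<close> norms(2) by (simp add: z_def dist_norm)
  then have "0 \<le> cross2 e (z - p)"
    using \<open>s < r\<close> by (intro pos) simp
  also have "cross2 e (z - p) = cross2 e (y - p) - s / norm e * (norm e * norm e)"
    unfolding norms(1) by (simp add: cross2_def z_def w_def algebra_simps)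
  finally show ?thesis
    using False by simp
qed

text \<open>The centre splits the triangle into three triangles over its edges, each of height at
  least \<open>s\<close>; their doubled areas add up to the cross product.\<close>

lemma inscribed_ball_perimeter:
  fixes A B C :: "real^2"
  assumes J: "0 \<le> cross2 (B - A) (C - A)"
    and ball: "ball y r \<subseteq> convex hull {A, B, C}" and s: "0 \<le> s" "s < r"
  shows "s * (dist A B + dist B C + dist A C) \<le> cross2 (B - A) (C - A)"
proof -
  have "0 \<le> cross2 (B - A) (z - A) \<and> 0 \<le> cross2 (C - B) (z - B) \<and> 0 \<le> cross2 (A - C) (z - C)"
    if z: "z \<in> convex hull {A, B, C}" for z
  proof -
    obtain u v w where uvw: "0 \<le> u" "0 \<le> v" "0 \<le> w" "u + v + w = 1"
      and z: "z = u *\<^sub>R A + v *\<^sub>R B + w *\<^sub>R C"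
      using z unfolding convex_hull_3 by blast
    have u: "u = 1 - v - w" using uvw by simp
    \<comment> \<open>Each cross product is the barycentric coordinate of the opposite vertex times
      that of the whole triangle.\<close>
    have "cross2 (B - A) (z - A) = w * cross2 (B - A) (C - A)"
         "cross2 (C - B) (z - B) = u * cross2 (B - A) (C - A)"
         "cross2 (A - C) (z - C) = v * cross2 (B - A) (C - A)"
      by (simp_all add: cross2_def z u algebra_simps)
    then show ?thesis using uvw J by simp
  qed
  then have "s * norm (B - A) \<le> cross2 (B - A) (y - A)" "s * norm (C - B) \<le> cross2 (C - B) (y - B)"
      "s * norm (A - C) \<le> cross2 (A - C) (y - C)"
    using ball s by (auto intro!: cross2_ball_ge[where r = r])
  moreover have "cross2 (B - A) (y - A) + cross2 (C - B) (y - B) + cross2 (A - C) (y - C)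
      = cross2 (B - A) (C - A)"
    by (simp add: cross2_def algebra_simps)
  ultimately show ?thesis
    by (simp add: dist_norm norm_minus_commute algebra_simps)
qed

text \<open>The optimal constant is \<open>3 * sqrt 3\<close>, attained by the equilateral triangle; any constant
  above \<open>pi\<close> would do.\<close>

lemma inscribed_ball_area:
  fixes A B C :: "real^2"
  assumes J: "0 < cross2 (B - A) (C - A)"
    and ball: "ball y r \<subseteq> convex hull {A, B, C}" and s: "0 \<le> s" "s < r"
  shows "5 * s\<^sup>2 \<le> cross2 (B - A) (C - A) / 2"
proof -
  define a b c where "a = dist B C" and "b = dist A C" and "c = dist A B"
  define p where "p = (a + b + c) / 2"
  define D where "D = cross2 (B - A) (C - A) / 2"
  have tri: "0 \<le> p - a" "0 \<le> p - b" "0 \<le> p - c"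
    using dist_triangle[of A B C] dist_triangle[of A C B] dist_triangle[of B C A]
    by (auto simp: p_def a_def b_def c_def dist_commute)
  have p0: "0 \<le> p"
    by (simp add: p_def a_def b_def c_def)
  have "sqrt (p * (p - a) * (p - b) * (p - c)) = D"
    using heron[of A B C] content_triangle[of A B C] J
    unfolding p_def a_def b_def c_def D_def cross2_def by (simp add: algebra_simps)
  then have heron: "D\<^sup>2 = p * ((p - a) * (p - b) * (p - c))"
    using tri p0 real_sqrt_pow2[of "p * (p - a) * (p - b) * (p - c)"] by (simp add: mult.assoc)
  \<comment> \<open>The three factors add up to \<open>p\<close>, so Heron's formula yields the
    isoperimetric inequality \<open>27 * D^2 \<le> p^4\<close>.\<close>
  have "27 * ((p - a) * (p - b) * (p - c)) \<le> ((p - a) + (p - b) + (p - c)) ^ 3"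
    by (rule am_gm_3[OF tri])
  also have "(p - a) + (p - b) + (p - c) = p"
    by (simp add: p_def field_simps)
  finally have "p * (27 * ((p - a) * (p - b) * (p - c))) \<le> p * p ^ 3"
    using p0 by (intro mult_left_mono)
  then have up: "27 * D\<^sup>2 \<le> p ^ 4"
    unfolding heron by (simp add: power4_eq_xxxx power3_eq_cube mult_ac)
  have "D > 0" using J by (simp add: D_def)
  with up have "p > 0"
    using p0 by (cases "p = 0") (auto simp: zero_less_power2)
  have "s * p \<le> D"
    using inscribed_ball_perimeter[OF less_imp_le[OF J] ball s]
    by (simp add: D_def p_def a_def b_def c_def field_simps)
  \<comment> \<open>In fourth powers the isoperimetric inequality applies and \<open>p\<close>
    cancels. This leaves \<open>27 * s^4 \<le> D^2\<close>, and 25 below 27 gives the constant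
    5.\<close>
  then have "(s * p) ^ 4 \<le> D ^ 4"
    using s p0 by (intro power_mono) auto
  then have "27 * (s ^ 4 * p ^ 4) \<le> D\<^sup>2 * (27 * D\<^sup>2)"
    by (simp add: power_mult_distrib flip: power_add)
  also have "\<dots> \<le> D\<^sup>2 * p ^ 4"
    using up by (intro mult_left_mono) auto
  finally have "27 * s ^ 4 \<le> D\<^sup>2"
    using \<open>p > 0\<close> by simp
  moreover have "(5 * s\<^sup>2)\<^sup>2 = 25 * s ^ 4" and "0 \<le> s ^ 4"
    using s(1) by (simp_all add: power_mult_distrib flip: power_mult)
  ultimately have "(5 * s\<^sup>2)\<^sup>2 \<le> D\<^sup>2"
    by linarith
  then have "5 * s\<^sup>2 \<le> D"
    using \<open>D > 0\<close> by (rule power2_le_imp_le[OF _ less_imp_le])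
  then show ?thesis by (simp add: D_def)
qed

text \<open>The estimate for all \<open>s < r\<close> passes to \<open>r\<close> by density and then
  to the supremum, which is taken over a bounded set containing 0.\<close>

lemma inradius_triangle:
  fixes A B C :: "real^2"
  assumes J: "0 < cross2 (B - A) (C - A)"
  defines "K \<equiv> interior (convex hull {A, B, C})"
  shows "5 * (inradius K)\<^sup>2 \<le> cross2 (B - A) (C - A) / 2"
proof -
  define D where "D = cross2 (B - A) (C - A) / 2"
  define R where "R = {r. 0 \<le> r \<and> (\<exists>x. ball x r \<subseteq> K)}"
  have bound: "r \<le> sqrt (D / 5)" if r: "r \<in> R" for r
  proof (rule dense_le)
    fix s assume "s < r"
    show "s \<le> sqrt (D / 5)"
    proof (cases "0 \<le> s")
      case True
      obtain y where "ball y r \<subseteq> convex hull {A, B, C}"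
        using r interior_subset unfolding R_def K_def by blast
      from inscribed_ball_area[OF J this True \<open>s < r\<close>] show ?thesis
        by (intro real_le_rsqrt) (simp add: D_def)
    next
      case False
      then show ?thesis
        using J by (intro order.trans[of s 0 "sqrt (D / 5)"]) (auto simp: D_def)
    qed
  qed
  have "0 \<in> R" by (simp add: R_def)
  have "0 \<le> Sup R"
    using bound \<open>0 \<in> R\<close> by (intro cSup_upper bdd_aboveI)
  moreover have "Sup R \<le> sqrt (D / 5)"
    using bound \<open>0 \<in> R\<close> by (intro cSup_least) auto
  moreover have "inradius K = Sup R"
    by (simp add: inradius_def R_def)
  ultimately show "5 * (inradius K)\<^sup>2 \<le> cross2 (B - A) (C - A) / 2"
    using power_mono[of "Sup R" "sqrt (D / 5)" 2] J by (simp add: D_def)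
qed

section \<open>Determinant and inverse of a 2 by 2 matrix\<close>

lemma det_tri_matrix: "det (tri_matrix x) = cross2 (x 2 - x 1) (x 3 - x 1)"
  by (simp add: det_2 tri_matrix_def cross2_def algebra_simps)

text \<open>The adjugate. It is linear in \<open>A\<close>, so the determinant times the inverse is
  continuous in time without any division.\<close>

definition adj2 :: "real^2^2 \<Rightarrow> real^2^2" where
  "adj2 A = vector [vector [A$2$2, - (A$1$2)], vector [- (A$2$1), A$1$1]]"

lemma matrix_inv_unique:
  fixes A X :: "real^'n^'n"
  assumes "A ** X = mat 1" "X ** A = mat 1"
  shows "matrix_inv A = X"
proof -
  have "A ** matrix_inv A = mat 1 \<and> matrix_inv A ** A = mat 1"
    unfolding matrix_inv_def by (rule someI[of _ X]) (simp add: assms)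
  then have "matrix_inv A = (X ** A) ** matrix_inv A" and "A ** matrix_inv A = mat 1"
    using assms by simp_all
  then show ?thesis
    by (simp flip: matrix_mul_assoc)
qed

lemma matrix_inv_2:
  assumes "det A \<noteq> 0"
  shows "matrix_inv A = (1 / det A) *\<^sub>R adj2 A"
proof (rule matrix_inv_unique)
  have scaleR_right: "X ** (c *\<^sub>R Y) = c *\<^sub>R (X ** Y)"
    and scaleR_left: "(c *\<^sub>R X) ** Y = c *\<^sub>R (X ** Y)" for X Y :: "real^2^2" and c :: real
    by (simp_all add: vec_eq_iff matrix_matrix_mult_def sum_2 algebra_simps)
  have eq: "A ** adj2 A = det A *\<^sub>R mat 1" "adj2 A ** A = det A *\<^sub>R mat 1"
    by (simp_all add: vec_eq_iff forall_2 matrix_matrix_mult_def sum_2 adj2_def det_2 mat_def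
        algebra_simps)
  show "A ** ((1 / det A) *\<^sub>R adj2 A) = mat 1" "((1 / det A) *\<^sub>R adj2 A) ** A = mat 1"
    using assms eq by (simp_all add: scaleR_right scaleR_left)
qed

section \<open>Kinematics of a cell\<close>

text \<open>The time derivative of \<open>A_at\<close> within the slab, and also the derivative
  matrix of the grid velocity in \<xi>; it does not depend on time.\<close>

definition mesh_vel :: "('v, 'c) mesh \<Rightarrow> nat \<Rightarrow> 'c \<Rightarrow> real^2^2" where
  "mesh_vel S n c = (1 / step S n) *\<^sub>R
     tri_matrix (\<lambda>l. pos S (Suc n) (vtx S c l) - pos S n (vtx S c l))"

definition vertex_vel :: "('v, 'c) mesh \<Rightarrow> nat \<Rightarrow> 'c \<Rightarrow> real^2" where
  "vertex_vel S n c = (1 / step S n) *\<^sub>R (pos S (Suc n) (vtx S c 1) - pos S n (vtx S c 1))"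

lemma A_at_affine:
  "A_at S n c t = tri_matrix (\<lambda>l. pos S n (vtx S c l)) + (t - tlev S n) *\<^sub>R mesh_vel S n c"
proof -
  obtain q where q: "q = (t - tlev S n) / step S n" by simp
  then have "(t - tlev S n) *\<^sub>R mesh_vel S n c
      = q *\<^sub>R tri_matrix (\<lambda>l. pos S (Suc n) (vtx S c l) - pos S n (vtx S c l))"
    by (simp add: mesh_vel_def)
  then show ?thesis
    by (simp add: A_at_def tri_matrix_def vert_def vec_eq_iff algebra_simps flip: q)
qed

lemma velocity_affine: "velocity S n c t \<xi> = mesh_vel S n c *v \<xi> + vertex_vel S n c"
proof -
  let ?v = "mesh_vel S n c *v \<xi> + vertex_vel S n c"
  have "cell_map S n c s \<xi> = (tri_matrix (\<lambda>l. pos S n (vtx S c l)) *v \<xi> + pos S n (vtx S c 1))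
      + (s - tlev S n) *\<^sub>R ?v" for s
    by (simp add: cell_map_def A_at_affine matrix_vector_mult_add_rdistrib vert_def
        vertex_vel_def scaleR_matrix_vector_assoc[symmetric] algebra_simps diff_divide_distrib)
  then have "((\<lambda>s. cell_map S n c s \<xi>) has_vector_derivative ?v) (at t)"
    by (auto intro!: derivative_eq_intros)
  then show ?thesis
    unfolding velocity_def by (rule vector_derivative_at)
qed

lemma div_velocity_trace: "div_velocity S n c t = trace (matrix_inv (A_at S n c t) ** mesh_vel S n c)"
proof -
  let ?B = "matrix_inv (A_at S n c t) ** mesh_vel S n c"
  have "(\<lambda>\<xi>. matrix_inv (A_at S n c t) *v velocity S n c t \<xi>)
      = (\<lambda>\<xi>. ?B *v \<xi> + matrix_inv (A_at S n c t) *v vertex_vel S n c)"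
    by (simp add: velocity_affine matrix_vector_right_distrib matrix_vector_mul_assoc)
  moreover have "((\<lambda>\<xi>. ?B *v \<xi> + matrix_inv (A_at S n c t) *v vertex_vel S n c)
      has_derivative (*v) ?B) (at 0)"
    by (auto intro!: derivative_eq_intros bounded_linear_imp_has_derivative
        matrix_vector_mul_bounded_linear)
  ultimately have "frechet_derivative (\<lambda>\<xi>. matrix_inv (A_at S n c t) *v velocity S n c t \<xi>) (at 0)
      = (*v) ?B"
    by (metis frechet_derivative_at)
  then show ?thesis
    unfolding div_velocity_def divergence_def trace_def
    by (simp add: matrix_vector_mult_basis column_def)
qed

lemma div_velocity_mult_J:
  assumes "0 < J_at S n c t"
  shows "div_velocity S n c t * J_at S n c t = trace (adj2 (A_at S n c t) ** mesh_vel S n c)"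
  using assms unfolding div_velocity_trace J_at_def
  by (simp add: matrix_inv_2 trace_def sum_2 matrix_matrix_mult_def field_simps)

lemma J_at_cross2:
  "J_at S n c t = cross2 (vert S n c t 2 - vert S n c t 1) (vert S n c t 3 - vert S n c t 1)"
  by (simp add: J_at_def A_at_def det_tri_matrix)

text \<open>The frontier of a convex set is negligible, so the interior has the area of the hull;
  the sign of the Jacobian removes the absolute value.\<close>

lemma area_at_J:
  assumes "0 \<le> J_at S n c t"
  shows "area_at S n c t = J_at S n c t / 2"
proof -
  let ?H = "convex hull {vert S n c t 1, vert S n c t 2, vert S n c t 3}"
  have "area_at S n c t = measure lebesgue ?H"
    unfolding area_at_def K_at_def
    by (intro measure_interior negligible_convex_frontier) (auto simp: finite_imp_bounded_convex_hull)
  then show ?thesis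
    using assms by (simp add: measure_lebesgue_triangle J_at_cross2 cross2_def algebra_simps)
qed

lemma area_gt_inradius:
  assumes "0 < J_at S n c t"
  shows "pi * (inradius (K_at S n c t))\<^sup>2 < area_at S n c t"
proof -
  let ?r = "inradius (K_at S n c t)"
  have r: "5 * ?r\<^sup>2 \<le> J_at S n c t / 2"
    using inradius_triangle[of "vert S n c t 2" "vert S n c t 1" "vert S n c t 3"] assms
    unfolding K_at_def J_at_cross2 by simp
  \<comment> \<open>The number 4 lies strictly between \<open>pi\<close> and 5, which gives
    strictness for a nonzero inradius; for inradius 0 it comes from the positive Jacobian.\<close>
  have "pi * ?r\<^sup>2 \<le> 4 * ?r\<^sup>2"
    using pi_less_4 by (intro mult_right_mono) auto
  have "pi * ?r\<^sup>2 < J_at S n c t / 2"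
  proof (cases "?r = 0")
    case False
    then have "4 * ?r\<^sup>2 < 5 * ?r\<^sup>2" by simp
    with r \<open>pi * ?r\<^sup>2 \<le> 4 * ?r\<^sup>2\<close> show ?thesis by linarith
  qed (use assms in simp)
  then show "pi * ?r\<^sup>2 < area_at S n c t"
    using assms by (simp add: area_at_J)
qed

lemma continuous_on_A_at: "continuous_on X (\<lambda>t. A_at S n c t $ i $ j)"
  unfolding A_at_affine by (auto intro!: continuous_intros)

lemma continuous_on_adj2_A_at: "continuous_on X (\<lambda>t. adj2 (A_at S n c t))"
proof -
  have "adj2 A $ 1 $ 1 = A $ 2 $ 2" "adj2 A $ 1 $ 2 = - (A $ 1 $ 2)" "adj2 A $ 2 $ 1 = - (A $ 2 $ 1)"
    "adj2 A $ 2 $ 2 = A $ 1 $ 1" for A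
    by (simp_all add: adj2_def)
  then have "continuous_on X (\<lambda>t. adj2 (A_at S n c t) $ i $ j)" for i j
    using exhaust_2[of i] exhaust_2[of j]
    by (auto intro!: continuous_on_minus continuous_on_A_at)
  then have "continuous_on X (\<lambda>t. \<chi> i. \<chi> j. adj2 (A_at S n c t) $ i $ j)"
    by (intro continuous_on_vec_lambda)
  then show ?thesis by simp
qed

section \<open>Discrete geometric conservation law\<close>

text \<open>The outward normal scaled by the edge length, which avoids the square root of the
  slanted edge.\<close>

definition rot_tangent :: "3 \<Rightarrow> real^2" where
  "rot_tangent \<nu> = vector [ref_tangent \<nu> $ 2, - (ref_tangent \<nu> $ 1)]"

lemma rot_tangent_simps:
  "rot_tangent 1 = vector [0, -1]" "rot_tangent 2 = vector [1, 1]" "rot_tangent 3 = vector [-1, 0]"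
  by (simp_all add: rot_tangent_def ref_tangent_def ref_vertex_def vec_eq_iff forall_2)

lemma ref_len_pos: "0 < ref_len \<nu>"
  unfolding ref_len_def
  using exhaust_3[of \<nu>] by (auto simp: ref_tangent_def ref_vertex_def vec_eq_iff forall_2)

lemma ref_len_normal: "ref_len \<nu> *\<^sub>R ref_normal \<nu> = rot_tangent \<nu>"
  using ref_len_pos[of \<nu>] by (simp add: ref_normal_def rot_tangent_def)

text \<open>Piola transform on one edge: moving the transpose across the inner product pulls the
  flux back to the reference edge.\<close>

lemma flux_through_edge:
  "ref_len \<nu> * (w \<bullet> cell_normal S n c J t \<nu>) = J * ((matrix_inv (A_at S n c t) *v w) \<bullet> rot_tangent \<nu>)"
proof -
  have "ref_len \<nu> * (w \<bullet> cell_normal S n c J t \<nu>)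
      = J * (w \<bullet> (transpose (matrix_inv (A_at S n c t)) *v (ref_len \<nu> *\<^sub>R ref_normal \<nu>)))"
    by (simp add: cell_normal_def matrix_vector_mult_scaleR)
  then show ?thesis
    by (simp add: ref_len_normal dot_lmul_matrix[symmetric] inner_commute
        vector_transpose_matrix transpose_matrix_vector)
qed

text \<open>The Gauss weights add up to 1, and the length-weighted outward normals of a triangle add
  up to 0.\<close>

lemma constant_flux_balance:
  assumes "gauss_rule k Q"
  shows "(\<Sum>\<nu>\<in>UNIV. \<Sum>\<beta>=1..k+1. gwt Q \<beta> * ref_len \<nu> * (w \<bullet> cell_normal S n c J t \<nu>)) = 0"
proof -
  let ?z = "matrix_inv (A_at S n c t) *v w"
  have "(\<Sum>\<beta>=1..k+1. gwt Q \<beta> * ref_len \<nu> * (w \<bullet> cell_normal S n c J t \<nu>))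
      = J * (?z \<bullet> rot_tangent \<nu>)" for \<nu>
    unfolding mult.assoc flux_through_edge sum_distrib_right[symmetric]
    by (simp only: gauss_rule_moments(1)[OF assms] mult_1)
  then have "(\<Sum>\<nu>\<in>UNIV. \<Sum>\<beta>=1..k+1. gwt Q \<beta> * ref_len \<nu> * (w \<bullet> cell_normal S n c J t \<nu>))
      = J * (?z \<bullet> rot_tangent 1) + J * (?z \<bullet> rot_tangent 2) + J * (?z \<bullet> rot_tangent 3)"
    by (simp only: sum_3)
  also have "\<dots> = 0"
    by (simp add: rot_tangent_simps inner_vec_def sum_2 algebra_simps)
  finally show ?thesis .
qed

text \<open>The divergence theorem for an affine field on \<open>K_ref\<close>, whose area is the
  factor 1/2.\<close>

lemma velocity_flux_balance:
  assumes Q: "gauss_rule k Q"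
  shows "(\<Sum>\<nu>\<in>UNIV. \<Sum>\<beta>=1..k+1. gwt Q \<beta> * ref_len \<nu>
            * (velocity S n c t (edge_point Q \<nu> \<beta>) \<bullet> cell_normal S n c J t \<nu>))
         = J / 2 * div_velocity S n c t"
proof -
  define V where "V = matrix_inv (A_at S n c t) ** mesh_vel S n c"
  define b where "b = matrix_inv (A_at S n c t) *v vertex_vel S n c"
  define mid where "mid \<nu> = (1/2) *\<^sub>R (ref_vertex \<nu> + ref_vertex (\<nu> + 1))" for \<nu>
  \<comment> \<open>Along an edge the flux is its midpoint value plus a term linear in the Gauss
    node, which the vanishing first moment removes.\<close>
  have "ref_len \<nu> * (velocity S n c t (edge_point Q \<nu> \<beta>) \<bullet> cell_normal S n c J t \<nu>)
      = J * ((V *v mid \<nu> + b) \<bullet> rot_tangent \<nu>)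
        + gnode Q \<beta> * (J * ((V *v ref_tangent \<nu>) \<bullet> rot_tangent \<nu>))" for \<nu> \<beta>
  proof -
    have "edge_point Q \<nu> \<beta> = mid \<nu> + gnode Q \<beta> *\<^sub>R ref_tangent \<nu>"
      by (simp add: edge_point_def mid_def ref_tangent_def algebra_simps)
    then have "matrix_inv (A_at S n c t) *v velocity S n c t (edge_point Q \<nu> \<beta>)
        = (V *v mid \<nu> + b) + gnode Q \<beta> *\<^sub>R (V *v ref_tangent \<nu>)"
      by (simp add: velocity_affine V_def b_def matrix_vector_right_distrib matrix_vector_mul_assoc
          matrix_vector_mult_scaleR)
    then show ?thesis
      by (simp add: flux_through_edge inner_add_left algebra_simps)
  qed
  then have "(\<Sum>\<beta>=1..k+1. gwt Q \<beta> * ref_len \<nu>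
            * (velocity S n c t (edge_point Q \<nu> \<beta>) \<bullet> cell_normal S n c J t \<nu>))
      = (\<Sum>\<beta>=1..k+1. gwt Q \<beta>) * (J * ((V *v mid \<nu> + b) \<bullet> rot_tangent \<nu>))
        + (\<Sum>\<beta>=1..k+1. gwt Q \<beta> * gnode Q \<beta>) * (J * ((V *v ref_tangent \<nu>) \<bullet> rot_tangent \<nu>))" for \<nu>
    unfolding sum_distrib_right sum.distrib[symmetric]
    by (intro sum.cong) (simp_all add: mult.assoc distrib_left)
  then have "(\<Sum>\<nu>\<in>UNIV. \<Sum>\<beta>=1..k+1. gwt Q \<beta> * ref_len \<nu>
            * (velocity S n c t (edge_point Q \<nu> \<beta>) \<bullet> cell_normal S n c J t \<nu>))
      = (\<Sum>\<nu>\<in>UNIV. J * ((V *v mid \<nu> + b) \<bullet> rot_tangent \<nu>))"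
    unfolding gauss_rule_moments[OF Q] by simp
  also have "\<dots> = J / 2 * trace V"
    by (simp add: sum_3 sum_2 rot_tangent_simps mid_def UNIV_3_succ ref_vertex_def trace_def
        inner_vec_def matrix_vector_mult_def algebra_simps)
  finally show ?thesis
    by (simp add: div_velocity_trace V_def)
qed

section \<open>Monotonicity of one Euler step\<close>

lemma ale_flux_has_vector_derivative:
  assumes "f C1_differentiable_on UNIV"
  shows "(ale_flux f w has_vector_derivative vector_derivative f (at u) - w) (at u)"
proof -
  have "(f has_vector_derivative vector_derivative f (at u)) (at u)"
    using assms unfolding C1_differentiable_on_eq by (simp add: vector_derivative_works)
  then show ?thesis
    unfolding ale_flux_def[abs_def] by (auto intro!: derivative_eq_intros)
qed

lemmas vector_derivative_ale_flux = vector_derivative_at[OF ale_flux_has_vector_derivative]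

lemma ale_flux_lipschitz:
  assumes f: "f C1_differentiable_on UNIV"
    and bd: "\<And>u. u \<in> {m..M} \<Longrightarrow> \<bar>vector_derivative (ale_flux f w) (at u) \<bullet> \<n>\<bar> \<le> lam"
    and ab: "a \<in> {m..M}" "b \<in> {m..M}"
  shows "\<bar>ale_flux f w a \<bullet> \<n> - ale_flux f w b \<bullet> \<n>\<bar> \<le> lam * \<bar>a - b\<bar>"
proof -
  have "(ale_flux f w has_vector_derivative vector_derivative (ale_flux f w) (at u)) (at u)" for u
    using ale_flux_has_vector_derivative[OF f] by (simp add: vector_derivative_ale_flux[OF f])
  then have der: "((\<lambda>u. ale_flux f w u \<bullet> \<n>) has_field_derivative
      vector_derivative (ale_flux f w) (at u) \<bullet> \<n>) (at u within {m..M})" for u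
    unfolding has_real_derivative_iff_has_vector_derivative
    by (rule bounded_linear.has_vector_derivative
        [OF bounded_linear_inner_left has_vector_derivative_at_within])
  show ?thesis
    using field_differentiable_bound[OF convex_real_interval(5) der _ ab, of lam] bd by simp
qed

text \<open>\<open>lam\<close> dominates the slope of the flux. Hence replacing both states by
  \<open>C\<close> costs at most \<open>lam * (e * (C - a))\<close> in the interior half, and the
  exterior half changes with the favourable sign.\<close>

lemma lf_flux_one_sided:
  assumes f: "f C1_differentiable_on UNIV"
    and bd: "\<And>u. u \<in> {m..M} \<Longrightarrow> \<bar>vector_derivative (ale_flux f w) (at u) \<bullet> \<n>\<bar> \<le> lam"
    and abC: "a \<in> {m..M}" "b \<in> {m..M}" "C \<in> {m..M}"
    and e: "\<bar>e\<bar> = 1" "0 \<le> e * (C - a)" "0 \<le> e * (C - b)"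
  shows "e * (ale_flux f w C \<bullet> \<n> - lf_flux f lam w a b \<n>) \<le> lam * (e * (C - a))"
proof -
  let ?G = "\<lambda>u. ale_flux f w u \<bullet> \<n>"
  have lip: "\<bar>e * (?G C - ?G u)\<bar> \<le> lam * (e * (C - u))" if "u \<in> {m..M}" "0 \<le> e * (C - u)" for u
  proof -
    have "\<bar>e * (?G C - ?G u)\<bar> = \<bar>?G C - ?G u\<bar>"
      using e(1) by (simp add: abs_mult)
    also have "\<dots> \<le> lam * \<bar>C - u\<bar>"
      using f bd abC(3) that(1) by (rule ale_flux_lipschitz)
    also have "\<bar>C - u\<bar> = \<bar>e * (C - u)\<bar>"
      using e(1) by (simp add: abs_mult)
    also have "\<dots> = e * (C - u)"
      using that(2) by simp
    finally show ?thesis .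
  qed
  have half: "1/2 * (p + q) - 1/2 * (r - s) \<le> p" if "\<bar>q\<bar> \<le> p" "\<bar>s\<bar> \<le> r" for p q r s :: real
    using abs_le_D1[OF that(1)] abs_le_D1[OF that(2)] by (simp add: field_simps)
  have "e * (?G C - lf_flux f lam w a b \<n>)
      = 1/2 * (lam * (e * (C - a)) + e * (?G C - ?G a))
        - 1/2 * (lam * (e * (C - b)) - e * (?G C - ?G b))"
    by (simp add: lf_flux_def algebra_simps)
  then show ?thesis
    using half[OF lip[OF abC(1) e(2)] lip[OF abC(2) e(3)]] by simp
qed

lemma dg_rhs_one:
  "dg_rhs f S k Q B lam n c w (\<lambda>_. 1) J t =
     - (\<Sum>\<nu>\<in>UNIV. \<Sum>\<beta>=1..k+1. gwt Q \<beta> * ref_len \<nu>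
          * lf_flux f lam (velocity S n c t (edge_point Q \<nu> \<beta>))
              (interior_value Q w c \<nu> \<beta>) (exterior_value S Q B n t w c \<nu> \<beta>)
              (cell_normal S n c J t \<nu>))"
proof -
  have "grad (\<lambda>_. 1) \<xi> = 0" for \<xi>
    by (simp add: grad_def vec_eq_iff)
  then show ?thesis
    by (simp add: dg_rhs_def)
qed

text \<open>The sign \<open>e\<close> covers the upper bound (\<open>e = 1\<close>, \<open>C = M\<close>) and the lower bound
  (\<open>e = -1\<close>, \<open>C = m\<close>) at once. By the discrete geometric conservation law the constant \<open>C\<close> is
  transported exactly, so only the deviations from \<open>C\<close> have to be estimated.\<close>

lemma euler_step_one_sided:
  assumes quad: "triangle_rule k Q" and w: "w c \<in> Pk k"
    and nodes: "\<And>\<xi>. \<xi> \<in> quad_nodes k Q \<Longrightarrow> 0 \<le> e * (C - w c \<xi>)"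
    and flux: "\<And>\<nu> \<beta>. \<beta> \<in> {1..k+1} \<Longrightarrow>
        e * (ale_flux f (velocity S n c t (edge_point Q \<nu> \<beta>)) C \<bullet> cell_normal S n c (2 * a) t \<nu>
          - lf_flux f lam (velocity S n c t (edge_point Q \<nu> \<beta>))
              (interior_value Q w c \<nu> \<beta>) (exterior_value S Q B n t w c \<nu> \<beta>)
              (cell_normal S n c (2 * a) t \<nu>))
        \<le> lam * (e * (C - interior_value Q w c \<nu> \<beta>))"
    and a: "0 \<le> a" and dt: "0 \<le> dt" and cfl: "\<And>\<nu>. dt * (lam * ref_len \<nu>) \<le> sigma_hat k * a"
  shows "0 \<le> e * (C * (a + dt * div_velocity S n c t * a)
    - (a * cell_avg (w c) + dt * dg_rhs f S k Q B lam n c w (\<lambda>_. 1) (2 * a) t))"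
proof -
  have gauss: "gauss_rule k Q" and gwt: "\<And>\<beta>. \<beta> \<in> {1..k+1} \<Longrightarrow> 0 < gwt Q \<beta>"
    and iwt: "\<And>\<gamma>. \<gamma> \<in> {1..n_interior k} \<Longrightarrow> 0 < iwt Q \<gamma>"
    using quad unfolding triangle_rule_def by blast+
  define u where "u \<nu> \<beta> = w c (edge_point Q \<nu> \<beta>)" for \<nu> \<beta>
  define F where "F \<nu> \<beta> = lf_flux f lam (velocity S n c t (edge_point Q \<nu> \<beta>))
      (interior_value Q w c \<nu> \<beta>) (exterior_value S Q B n t w c \<nu> \<beta>)
      (cell_normal S n c (2 * a) t \<nu>)" for \<nu> \<beta>
  define FC where "FC \<nu> \<beta> = ale_flux f (velocity S n c t (edge_point Q \<nu> \<beta>)) C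
      \<bullet> cell_normal S n c (2 * a) t \<nu>" for \<nu> \<beta>
  \<comment> \<open>The contribution of \<open>f C\<close> cancels around the cell; the velocity
    contributes \<open>- C\<close> times the divergence times half of \<open>2 * a\<close>.\<close>
  have FC: "(\<Sum>\<nu>\<in>UNIV. \<Sum>\<beta>=1..k+1. gwt Q \<beta> * ref_len \<nu> * FC \<nu> \<beta>) = - C * (a * div_velocity S n c t)"
  proof -
    have "gwt Q \<beta> * ref_len \<nu> * FC \<nu> \<beta>
        = gwt Q \<beta> * ref_len \<nu> * (f C \<bullet> cell_normal S n c (2 * a) t \<nu>)
          - C * (gwt Q \<beta> * ref_len \<nu> * (velocity S n c t (edge_point Q \<nu> \<beta>) \<bullet> cell_normal S n c (2 * a) t \<nu>))"
      for \<nu> \<beta>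
      by (simp add: FC_def ale_flux_def algebra_simps)
    then have "(\<Sum>\<nu>\<in>UNIV. \<Sum>\<beta>=1..k+1. gwt Q \<beta> * ref_len \<nu> * FC \<nu> \<beta>)
        = (\<Sum>\<nu>\<in>UNIV. \<Sum>\<beta>=1..k+1. gwt Q \<beta> * ref_len \<nu> * (f C \<bullet> cell_normal S n c (2 * a) t \<nu>))
          - C * (\<Sum>\<nu>\<in>UNIV. \<Sum>\<beta>=1..k+1. gwt Q \<beta> * ref_len \<nu>
            * (velocity S n c t (edge_point Q \<nu> \<beta>) \<bullet> cell_normal S n c (2 * a) t \<nu>))"
      by (simp only: sum_subtractf sum_distrib_left)
    then show ?thesis
      unfolding constant_flux_balance[OF gauss] velocity_flux_balance[OF gauss] by simp
  qed
  \<comment> \<open>The constant \<open>C\<close> is also integrated exactly, so the deviation of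
    the average is a positive combination of nodal deviations.\<close>
  have avg: "C - cell_avg (w c)
      = (\<Sum>\<nu>\<in>UNIV. \<Sum>\<beta>=1..k+1. gwt Q \<beta> * sigma_hat k * (C - u \<nu> \<beta>))
        + (\<Sum>\<gamma>=1..n_interior k. iwt Q \<gamma> * (C - w c (inode Q \<gamma>)))"
    using triangle_rule_avg[OF quad w] triangle_rule_avg[OF quad const_in_Pk[of C]]
    unfolding u_def cell_avg_const by (simp only: right_diff_distrib sum_subtractf)
  have "C * (a + dt * div_velocity S n c t * a)
      - (a * cell_avg (w c) + dt * dg_rhs f S k Q B lam n c w (\<lambda>_. 1) (2 * a) t)
    = a * (C - cell_avg (w c))
      - dt * ((\<Sum>\<nu>\<in>UNIV. \<Sum>\<beta>=1..k+1. gwt Q \<beta> * ref_len \<nu> * FC \<nu> \<beta>)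
        - (\<Sum>\<nu>\<in>UNIV. \<Sum>\<beta>=1..k+1. gwt Q \<beta> * ref_len \<nu> * F \<nu> \<beta>))"
    unfolding FC dg_rhs_one F_def[symmetric] by (simp add: algebra_simps)
  \<comment> \<open>Each edge node pairs its share of the average with its own flux difference;
    interior nodes carry no flux.\<close>
  also have "\<dots> = (\<Sum>\<nu>\<in>UNIV. \<Sum>\<beta>=1..k+1. gwt Q \<beta> *
        (sigma_hat k * a * (C - u \<nu> \<beta>) - dt * ref_len \<nu> * (FC \<nu> \<beta> - F \<nu> \<beta>)))
      + a * (\<Sum>\<gamma>=1..n_interior k. iwt Q \<gamma> * (C - w c (inode Q \<gamma>)))"
  proof -
    have "gwt Q \<beta> * (sigma_hat k * a * (C - u \<nu> \<beta>) - dt * ref_len \<nu> * (FC \<nu> \<beta> - F \<nu> \<beta>))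
        = a * (gwt Q \<beta> * sigma_hat k * (C - u \<nu> \<beta>))
          - (dt * (gwt Q \<beta> * ref_len \<nu> * FC \<nu> \<beta>) - dt * (gwt Q \<beta> * ref_len \<nu> * F \<nu> \<beta>))" for \<nu> \<beta>
      by (simp add: algebra_simps)
    then show ?thesis
      by (simp only: avg sum_subtractf sum_distrib_left[symmetric] distrib_left right_diff_distrib)
  qed
  finally have dev: "C * (a + dt * div_velocity S n c t * a)
      - (a * cell_avg (w c) + dt * dg_rhs f S k Q B lam n c w (\<lambda>_. 1) (2 * a) t)
    = (\<Sum>\<nu>\<in>UNIV. \<Sum>\<beta>=1..k+1. gwt Q \<beta> *
        (sigma_hat k * a * (C - u \<nu> \<beta>) - dt * ref_len \<nu> * (FC \<nu> \<beta> - F \<nu> \<beta>)))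
      + a * (\<Sum>\<gamma>=1..n_interior k. iwt Q \<gamma> * (C - w c (inode Q \<gamma>)))" .
  have eq: "e * (C * (a + dt * div_velocity S n c t * a)
      - (a * cell_avg (w c) + dt * dg_rhs f S k Q B lam n c w (\<lambda>_. 1) (2 * a) t))
    = (\<Sum>\<nu>\<in>UNIV. \<Sum>\<beta>=1..k+1. gwt Q \<beta> *
        (sigma_hat k * a * (e * (C - u \<nu> \<beta>)) - dt * ref_len \<nu> * (e * (FC \<nu> \<beta> - F \<nu> \<beta>))))
      + a * (\<Sum>\<gamma>=1..n_interior k. iwt Q \<gamma> * (e * (C - w c (inode Q \<gamma>))))"
  proof -
    have "gwt Q \<beta> * (sigma_hat k * a * (e * (C - u \<nu> \<beta>)) - dt * ref_len \<nu> * (e * (FC \<nu> \<beta> - F \<nu> \<beta>)))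
        = e * (gwt Q \<beta> * (sigma_hat k * a * (C - u \<nu> \<beta>) - dt * ref_len \<nu> * (FC \<nu> \<beta> - F \<nu> \<beta>)))"
      and "iwt Q \<gamma> * (e * (C - w c (inode Q \<gamma>))) = e * (iwt Q \<gamma> * (C - w c (inode Q \<gamma>)))" for \<nu> \<beta> \<gamma>
      by (simp_all add: algebra_simps)
    with dev show ?thesis
      by (simp only: sum_distrib_left[symmetric] distrib_left mult.left_commute[of a e])
  qed
  \<comment> \<open>The flux difference costs at most \<open>dt * (lam * ref_len \<nu>)\<close>
    times the nodal deviation, which the share \<open>sigma_hat k * a\<close> covers by
    \<open>cfl\<close>.\<close>
  have "0 \<le> sigma_hat k * a * (e * (C - u \<nu> \<beta>)) - dt * ref_len \<nu> * (e * (FC \<nu> \<beta> - F \<nu> \<beta>))"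
    if \<beta>: "\<beta> \<in> {1..k+1}" for \<nu> \<beta>
  proof -
    have "dt * ref_len \<nu> * (e * (FC \<nu> \<beta> - F \<nu> \<beta>)) \<le> dt * ref_len \<nu> * (lam * (e * (C - u \<nu> \<beta>)))"
      using flux[OF \<beta>, of \<nu>] dt ref_len_pos[of \<nu>] unfolding FC_def F_def u_def interior_value_def
      by (intro mult_left_mono) auto
    also have "\<dots> = dt * (lam * ref_len \<nu>) * (e * (C - u \<nu> \<beta>))"
      by simp
    also have "\<dots> \<le> sigma_hat k * a * (e * (C - u \<nu> \<beta>))"
      using cfl nodes[OF edge_point_in_quad_nodes[OF \<beta>]] unfolding u_def
      by (intro mult_right_mono) auto
    finally show ?thesis by simp
  qed
  then have "0 \<le> (\<Sum>\<nu>\<in>UNIV. \<Sum>\<beta>=1..k+1. gwt Q \<beta> *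
      (sigma_hat k * a * (e * (C - u \<nu> \<beta>)) - dt * ref_len \<nu> * (e * (FC \<nu> \<beta> - F \<nu> \<beta>))))"
    using gwt by (intro sum_nonneg mult_nonneg_nonneg[OF less_imp_le])
  moreover have "0 \<le> (\<Sum>\<gamma>=1..n_interior k. iwt Q \<gamma> * (e * (C - w c (inode Q \<gamma>))))"
  proof (rule sum_nonneg, rule mult_nonneg_nonneg[OF less_imp_le])
    fix \<gamma> assume \<gamma>: "\<gamma> \<in> {1..n_interior k}"
    then show "0 < iwt Q \<gamma>" by (rule iwt)
    show "0 \<le> e * (C - w c (inode Q \<gamma>))"
      using \<gamma> by (intro nodes) (simp add: quad_nodes_def)
  qed
  ultimately show ?thesis
    unfolding eq using a by simp
qed

section \<open>Maximal wave speed\<close>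

text \<open>The wave speed is continuous in time, position and state on a compact set.
  \<open>J\<close> is left arbitrary so that both sets in \<open>lf_lambda\<close> are
  covered.\<close>

lemma bdd_above_wave_speed:
  assumes f: "f C1_differentiable_on UNIV"
    and X: "compact X" and N: "continuous_on X (\<lambda>t. cell_normal S n c (J t) t \<nu>)"
  shows "bdd_above {wave_speed f S n c (J t) t \<nu> \<xi> u | t \<xi> u. t \<in> X \<and> \<xi> \<in> ref_edge \<nu> \<and> u \<in> {m..M}}"
proof -
  let ?g = "\<lambda>z. \<bar>(vector_derivative f (at (snd (snd z))) - (mesh_vel S n c *v fst (snd z) + vertex_vel S n c))
      \<bullet> cell_normal S n c (J (fst z)) (fst z) \<nu>\<bar>"
  let ?D = "X \<times> ref_edge \<nu> \<times> {m..M}"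
  have D: "compact ?D"
    by (intro compact_Times X) (auto simp: ref_edge_def)
  have f': "continuous_on UNIV (\<lambda>u. vector_derivative f (at u))"
    using f unfolding C1_differentiable_on_eq by blast
  have "continuous_on ?D ?g"
    by (intro continuous_intros continuous_on_compose2[OF f'] continuous_on_compose2[OF N]
        bounded_linear.continuous_on[OF matrix_vector_mul_bounded_linear]) auto
  then have "bdd_above (?g ` ?D)"
    using D by (intro bounded_imp_bdd_above compact_imp_bounded compact_continuous_image)
  moreover have "{wave_speed f S n c (J t) t \<nu> \<xi> u | t \<xi> u. t \<in> X \<and> \<xi> \<in> ref_edge \<nu> \<and> u \<in> {m..M}}
      \<subseteq> ?g ` ?D"
    by (force simp: wave_speed_def vector_derivative_ale_flux[OF f] velocity_affine)
  ultimately show ?thesis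
    by (rule bdd_above_mono)
qed

lemma cell_normal_J_at:
  assumes "0 < J_at S n c t"
  shows "cell_normal S n c (J_at S n c t) t \<nu> = transpose (adj2 (A_at S n c t)) *v ref_normal \<nu>"
  using assms unfolding cell_normal_def J_at_def
  by (simp add: matrix_inv_2 transpose_scalar scaleR_matrix_vector_assoc[symmetric])

text \<open>\<open>Sup\<close> dominates the members only of a set bounded above. Both sets are
  finite unions, over cells and edges, of bounded sets.\<close>

lemma wave_speed_le_lf_lambda:
  assumes f: "f C1_differentiable_on UNIV" and fin: "finite (cells S)"
    and J: "\<And>c t. c \<in> cells S \<Longrightarrow> t \<in> slab S n \<Longrightarrow> 0 < J_at S n c t"
    and c: "c \<in> cells S" and \<xi>: "\<xi> \<in> ref_edge \<nu>" and u: "u \<in> {m..M}"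
  shows "t \<in> slab S n \<Longrightarrow> wave_speed f S n c (J_at S n c t) t \<nu> \<xi> u \<le> lf_lambda f S n m M"
    and "wave_speed f S n c (2 * area_stage1 S n c) (tlev S (Suc n)) \<nu> \<xi> u \<le> lf_lambda f S n m M"
proof -
  let ?A = "{wave_speed f S n c (J_at S n c t) t \<nu> \<xi> u | c t \<nu> \<xi> u.
         c \<in> cells S \<and> t \<in> slab S n \<and> \<xi> \<in> ref_edge \<nu> \<and> u \<in> {m..M}}"
  let ?B = "{wave_speed f S n c (2 * area_stage1 S n c) (tlev S (Suc n)) \<nu> \<xi> u | c \<nu> \<xi> u.
         c \<in> cells S \<and> \<xi> \<in> ref_edge \<nu> \<and> u \<in> {m..M}}"
  have "bdd_above {wave_speed f S n c (J_at S n c t) t \<nu> \<xi> u | t \<xi> u.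
      t \<in> slab S n \<and> \<xi> \<in> ref_edge \<nu> \<and> u \<in> {m..M}}" if "c \<in> cells S" for c \<nu>
  proof (rule bdd_above_wave_speed[OF f])
    show "compact (slab S n)"
      by (simp add: slab_def)
    have "continuous_on (slab S n) (\<lambda>t. transpose (adj2 (A_at S n c t)) *v ref_normal \<nu>)"
      unfolding transpose_def matrix_vector_mult_def
      by (auto intro!: continuous_intros continuous_on_vec_lambda continuous_on_adj2_A_at)
    then show "continuous_on (slab S n) (\<lambda>t. cell_normal S n c (J_at S n c t) t \<nu>)"
      using cell_normal_J_at J[OF that] by (metis (no_types, lifting) continuous_on_cong)
  qed
  then have "bdd_above (\<Union>c\<in>cells S. \<Union>\<nu>. {wave_speed f S n c (J_at S n c t) t \<nu> \<xi> u | t \<xi> u.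
      t \<in> slab S n \<and> \<xi> \<in> ref_edge \<nu> \<and> u \<in> {m..M}})"
    using fin by simp
  moreover have "?A = (\<Union>c\<in>cells S. \<Union>\<nu>. {wave_speed f S n c (J_at S n c t) t \<nu> \<xi> u | t \<xi> u.
      t \<in> slab S n \<and> \<xi> \<in> ref_edge \<nu> \<and> u \<in> {m..M}})"
    by blast
  ultimately have A: "bdd_above ?A"
    by simp
  \<comment> \<open>On a single time level continuity in time is trivial, so the stage value may
    replace the Jacobian.\<close>
  have "bdd_above {wave_speed f S n c (2 * area_stage1 S n c) t \<nu> \<xi> u | t \<xi> u.
      t \<in> {tlev S (Suc n)} \<and> \<xi> \<in> ref_edge \<nu> \<and> u \<in> {m..M}}" for c \<nu>
    by (rule bdd_above_wave_speed[OF f]) simp_all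
  then have "bdd_above (\<Union>c\<in>cells S. \<Union>\<nu>. {wave_speed f S n c (2 * area_stage1 S n c) t \<nu> \<xi> u | t \<xi> u.
      t \<in> {tlev S (Suc n)} \<and> \<xi> \<in> ref_edge \<nu> \<and> u \<in> {m..M}})"
    using fin by simp
  moreover have "?B = (\<Union>c\<in>cells S. \<Union>\<nu>. {wave_speed f S n c (2 * area_stage1 S n c) t \<nu> \<xi> u | t \<xi> u.
      t \<in> {tlev S (Suc n)} \<and> \<xi> \<in> ref_edge \<nu> \<and> u \<in> {m..M}})"
    by blast
  ultimately have B: "bdd_above ?B"
    by simp
  have le: "x \<le> lf_lambda f S n m M" if "x \<in> ?A \<union> ?B" for x
    unfolding lf_lambda_def using that A B by (intro cSup_upper) simp_all
  show "wave_speed f S n c (J_at S n c t) t \<nu> \<xi> u \<le> lf_lambda f S n m M" if "t \<in> slab S n"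
    using c \<xi> u that by (intro le UnI1) blast
  show "wave_speed f S n c (2 * area_stage1 S n c) (tlev S (Suc n)) \<nu> \<xi> u \<le> lf_lambda f S n m M"
    using c \<xi> u by (intro le UnI2) blast
qed

lemma euler_step_within:
  assumes f: "f C1_differentiable_on UNIV"
    and quad: "triangle_rule k Q" and w: "w c \<in> Pk k"
    and nodes: "\<And>\<xi>. \<xi> \<in> quad_nodes k Q \<Longrightarrow> w c \<xi> \<in> {m..M}"
    and ext: "\<And>\<nu> \<beta>. \<beta> \<in> {1..k+1} \<Longrightarrow> exterior_value S Q B n t w c \<nu> \<beta> \<in> {m..M}"
    and speed: "\<And>\<nu> \<xi> u. \<xi> \<in> ref_edge \<nu> \<Longrightarrow> u \<in> {m..M} \<Longrightarrow> wave_speed f S n c (2 * a) t \<nu> \<xi> u \<le> lam"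
    and a: "0 \<le> a" and dt: "0 \<le> dt" and cfl: "\<And>\<nu>. dt * (lam * ref_len \<nu>) \<le> sigma_hat k * a"
  shows "a * cell_avg (w c) + dt * dg_rhs f S k Q B lam n c w (\<lambda>_. 1) (2 * a) t
    \<in> {m * (a + dt * div_velocity S n c t * a) .. M * (a + dt * div_velocity S n c t * a)}"
proof -
  have gauss: "gauss_rule k Q"
    using quad unfolding triangle_rule_def by blast
  have "m \<le> M"
    using nodes[OF edge_point_in_quad_nodes[of 1 k Q 1]] by simp
  have one_sided: "0 \<le> e * (C * (a + dt * div_velocity S n c t * a)
      - (a * cell_avg (w c) + dt * dg_rhs f S k Q B lam n c w (\<lambda>_. 1) (2 * a) t))"
    if e: "\<bar>e\<bar> = 1" and C: "C \<in> {m..M}" and sgn: "\<And>x. x \<in> {m..M} \<Longrightarrow> 0 \<le> e * (C - x)" for e C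
  proof (rule euler_step_one_sided[where w = w and c = c, OF quad w _ _ a dt cfl])
    show "0 \<le> e * (C - w c \<xi>)" if "\<xi> \<in> quad_nodes k Q" for \<xi>
      using nodes[OF that] by (rule sgn)
  next
    fix \<nu> \<beta> assume \<beta>: "\<beta> \<in> {1..k+1}"
    have int: "interior_value Q w c \<nu> \<beta> \<in> {m..M}"
      unfolding interior_value_def by (intro nodes edge_point_in_quad_nodes \<beta>)
    show "e * (ale_flux f (velocity S n c t (edge_point Q \<nu> \<beta>)) C \<bullet> cell_normal S n c (2 * a) t \<nu>
          - lf_flux f lam (velocity S n c t (edge_point Q \<nu> \<beta>))
              (interior_value Q w c \<nu> \<beta>) (exterior_value S Q B n t w c \<nu> \<beta>)
              (cell_normal S n c (2 * a) t \<nu>))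
        \<le> lam * (e * (C - interior_value Q w c \<nu> \<beta>))"
    proof (rule lf_flux_one_sided[OF f _ int ext[OF \<beta>] C e sgn[OF int] sgn[OF ext[OF \<beta>]]])
      fix u assume "u \<in> {m..M}"
      from speed[OF edge_point_in_ref_edge[OF gauss \<beta>] this]
      show "\<bar>vector_derivative (ale_flux f (velocity S n c t (edge_point Q \<nu> \<beta>))) (at u)
          \<bullet> cell_normal S n c (2 * a) t \<nu>\<bar> \<le> lam"
        unfolding wave_speed_def .
    qed
  qed
  show ?thesis
    using one_sided[of 1 M] one_sided[of "-1" m] \<open>m \<le> M\<close> by simp
qed

section \<open>Values across an edge\<close>

lemma cell_map_ref_vertex: "cell_map S n c t (ref_vertex l) = vert S n c t l"
  using exhaust_3[of l]
  by (auto simp: cell_map_def A_at_def tri_matrix_def ref_vertex_def matrix_vector_mult_def sum_2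
      vec_eq_iff forall_2)

lemma cell_map_convex_combination:
  assumes "r + s = 1"
  shows "cell_map S n c t (r *\<^sub>R x + s *\<^sub>R y) = r *\<^sub>R cell_map S n c t x + s *\<^sub>R cell_map S n c t y"
proof -
  have "vert S n c t 1 = r *\<^sub>R vert S n c t 1 + s *\<^sub>R vert S n c t 1"
    using assms by (simp flip: scaleR_add_left)
  then show ?thesis
    by (simp add: cell_map_def matrix_vector_right_distrib matrix_vector_mult_scaleR scaleR_add_right)
qed

lemma cell_map_inv_cell_map:
  assumes "0 < J_at S n c t"
  shows "cell_map_inv S n c t (cell_map S n c t \<xi>) = \<xi>"
proof -
  have "invertible (A_at S n c t)"
    using assms by (simp add: invertible_det_nz J_at_def)
  then have "matrix_inv (A_at S n c t) ** A_at S n c t = mat 1"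
    unfolding matrix_inv_def invertible_def by (metis (mono_tags, lifting) someI_ex)
  then show ?thesis
    by (simp add: cell_map_inv_def cell_map_def matrix_vector_mul_assoc)
qed

text \<open>Coinciding vertices would make the cell degenerate. This keeps the ends of a shared edge
  distinct in the neighbouring cell.\<close>

lemma vtx_succ_neq:
  assumes "0 < J_at S n c t"
  shows "vtx S c \<nu> \<noteq> vtx S c (\<nu> + 1)"
proof
  assume "vtx S c \<nu> = vtx S c (\<nu> + 1)"
  then have "vert S n c t \<nu> = vert S n c t (\<nu> + 1)"
    by (simp add: vert_def)
  then have "J_at S n c t = 0"
    unfolding J_at_cross2 using exhaust_3[of \<nu>] by (auto simp: cross2_def UNIV_3_succ)
  with assms show False by simp
qed

text \<open>The Gauss points of the common edge are the same for both cells in either orientation,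
  because the Gauss nodes are symmetric.\<close>

lemma neighbour_edge_point:
  assumes Q: "gauss_rule k Q" and J: "0 < J_at S n c t" "0 < J_at S n d t"
    and nb: "neighbour S c \<nu> d" and \<beta>: "\<beta> \<in> {1..k+1}"
  obtains \<nu>' \<beta>' where "\<beta>' \<in> {1..k+1}"
    "cell_map_inv S n d t (cell_map S n c t (edge_point Q \<nu> \<beta>)) = edge_point Q \<nu>' \<beta>'"
proof -
  obtain l l' where l: "vtx S d l = vtx S c \<nu>" "vtx S d l' = vtx S c (\<nu> + 1)"
    using nb unfolding neighbour_def by auto
  then have vert: "vert S n c t \<nu> = vert S n d t l" "vert S n c t (\<nu> + 1) = vert S n d t l'"
    by (simp_all add: vert_def)
  have "cell_map S n c t (edge_point Q \<nu> \<beta>)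
      = (1/2 - gnode Q \<beta>) *\<^sub>R vert S n d t l + (1/2 + gnode Q \<beta>) *\<^sub>R vert S n d t l'"
    unfolding edge_point_def
    by (subst cell_map_convex_combination) (simp_all add: cell_map_ref_vertex vert)
  also have "\<dots> = cell_map S n d t ((1/2 - gnode Q \<beta>) *\<^sub>R ref_vertex l + (1/2 + gnode Q \<beta>) *\<^sub>R ref_vertex l')"
    by (subst cell_map_convex_combination) (simp_all add: cell_map_ref_vertex)
  finally have eq: "cell_map_inv S n d t (cell_map S n c t (edge_point Q \<nu> \<beta>))
      = (1/2 - gnode Q \<beta>) *\<^sub>R ref_vertex l + (1/2 + gnode Q \<beta>) *\<^sub>R ref_vertex l'"
    by (simp add: cell_map_inv_cell_map[OF J(2)])
  have "l \<noteq> l'"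
    using l vtx_succ_neq[OF J(1), of \<nu>] by auto
  \<comment> \<open>Distinct vertices of a triangle are cyclically adjacent, so the shared edge is
    an edge of \<open>d\<close>, run through in the same or the opposite direction.\<close>
  then consider "l' = l + 1" | "l = l' + 1"
    using exhaust_3[of l] exhaust_3[of l'] UNIV_3_succ by metis
  then show thesis
  proof cases
    case 1
    then show thesis
      using eq \<beta> by (intro that[of \<beta> l]) (auto simp: edge_point_def)
  next
    case 2
    \<comment> \<open>Reversing the edge swaps the two weights, that is, it negates the Gauss
      node.\<close>
    obtain \<beta>' where "\<beta>' \<in> {1..k+1}" "gnode Q \<beta>' = - gnode Q \<beta>"
      using gauss_rule_symmetric[OF Q \<beta>] .
    with 2 show thesis
      using eq by (intro that[of \<beta>' l']) (auto simp: edge_point_def add.commute)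
  qed
qed

lemma exterior_value_within:
  assumes Q: "gauss_rule k Q" and J: "\<And>c. c \<in> cells S \<Longrightarrow> 0 < J_at S n c t"
    and w: "nodes_within S k Q m M w" and c: "c \<in> cells S" and \<beta>: "\<beta> \<in> {1..k+1}"
    and bc: "(\<nexists>d. neighbour S c \<nu> d) \<Longrightarrow> B t w c \<nu> \<beta> \<in> {m..M}"
  shows "exterior_value S Q B n t w c \<nu> \<beta> \<in> {m..M}"
proof (cases "\<exists>d. neighbour S c \<nu> d")
  case True
  define d where "d = (SOME d. neighbour S c \<nu> d)"
  have nb: "neighbour S c \<nu> d"
    unfolding d_def using True by (rule someI_ex)
  then have d: "d \<in> cells S" by (simp add: neighbour_def)
  obtain \<nu>' \<beta>' where "\<beta>' \<in> {1..k+1}"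
    "cell_map_inv S n d t (cell_map S n c t (edge_point Q \<nu> \<beta>)) = edge_point Q \<nu>' \<beta>'"
    using neighbour_edge_point[OF Q J[OF c] J[OF d] nb \<beta>] .
  then show ?thesis
    using True w d edge_point_in_quad_nodes[of \<beta>' k Q \<nu>']
    by (simp add: exterior_value_def nodes_within_def flip: d_def)
next
  case False
  then show ?thesis
    using bc by (simp add: exterior_value_def)
qed

section \<open>The CFL condition\<close>

text \<open>A set of diameter 0 has at most one point and so no area, whereas the area is half the
  positive Jacobian.\<close>

lemma diameter_K_at_pos:
  assumes "0 < J_at S n c t"
  shows "0 < diameter (K_at S n c t)"
proof (rule ccontr)
  assume "\<not> 0 < diameter (K_at S n c t)"
  moreover have bd: "bounded (K_at S n c t)"
    unfolding K_at_def by (rule bounded_interior) (simp add: finite_imp_bounded_convex_hull)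
  ultimately have "dist x y \<le> 0" if "x \<in> K_at S n c t" "y \<in> K_at S n c t" for x y
    using diameter_bounded_bound[OF bd that] by linarith
  then have "x = y" if "x \<in> K_at S n c t" "y \<in> K_at S n c t" for x y
    using that by simp
  then obtain x where "K_at S n c t \<subseteq> {x}"
    by blast
  then have "negligible (K_at S n c t)"
    using negligible_subset negligible_sing by blast
  then have "area_at S n c t = 0"
    unfolding area_at_def by (rule negligible_imp_measure0)
  with assms show False
    by (simp add: area_at_J)
qed

lemma bounded_open_convex_polygon:
  assumes "open_convex_polygon \<Omega>"
  shows "bounded (closure \<Omega>)"
proof -
  obtain P where P: "polytope P" "\<Omega> = interior P"
    using assms unfolding open_convex_polygon_def by blast
  then have "bounded \<Omega>"
    by (simp add: bounded_interior polytope_imp_bounded)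
  then show ?thesis by (rule bounded_closure)
qed

text \<open>By (A1) every cell stays in the bounded closure of the domain, so the supremum
  \<open>mesh_size\<close> is over a bounded set.\<close>

lemma diameter_le_mesh_size:
  assumes bd: "bounded (closure \<Omega>)" and A1: "A1 \<Omega> S"
    and i: "i < nsteps S" "c \<in> cells S" "t \<in> slab S i"
  shows "diameter (K_at S i c t) \<le> mesh_size S"
proof -
  let ?D = "{diameter (K_at S i c t) | i c t. i < nsteps S \<and> c \<in> cells S \<and> t \<in> slab S i}"
  have "x \<le> diameter (closure \<Omega>)" if x: "x \<in> ?D" for x
  proof -
    obtain i c t where ict: "i < nsteps S" "c \<in> cells S" "t \<in> slab S i"
      and x: "x = diameter (K_at S i c t)"
      using x by blast
    have "closure \<Omega> = (\<Union>c\<in>cells S. closure (K_at S i c t))"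
      using A1 ict unfolding A1_def by blast
    then have "K_at S i c t \<subseteq> closure \<Omega>"
      using ict(2) closure_subset by blast
    then show ?thesis
      unfolding x by (rule diameter_subset[OF _ bd])
  qed
  then have "bdd_above ?D" by (rule bdd_aboveI)
  then show ?thesis
    unfolding mesh_size_def using i by (intro cSup_upper) blast
qed

lemma mesh_size_inradius:
  assumes bd: "bounded (closure \<Omega>)" and A1: "A1 \<Omega> S" and A2: "A2 S" and A3: "A3 S \<kappa> \<tau>"
    and i: "i < nsteps S" "c \<in> cells S" "t \<in> slab S i"
  shows "0 < mesh_size S" and "(mesh_size S)\<^sup>2 \<le> \<tau>\<^sup>2 * \<kappa>\<^sup>2 * (inradius (K_at S i c t))\<^sup>2"
proof -
  have J: "0 < J_at S i c t"
    using A2 i unfolding A2_def by blast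
  show pos: "0 < mesh_size S"
    using diameter_K_at_pos[OF J] diameter_le_mesh_size[OF bd A1 i] by linarith
  have "0 < \<tau>" and diam: "diameter (K_at S i c t) \<le> \<kappa> * inradius (K_at S i c t)"
    and "mesh_size S \<le> \<tau> * diameter (K_at S i c t)"
    using A3 i unfolding A3_def by blast+
  note this(3)
  also have "\<tau> * diameter (K_at S i c t) \<le> \<tau> * (\<kappa> * inradius (K_at S i c t))"
    using \<open>0 < \<tau>\<close> diam by (intro mult_left_mono) auto
  finally have "(mesh_size S)\<^sup>2 \<le> (\<tau> * (\<kappa> * inradius (K_at S i c t)))\<^sup>2"
    using pos by (intro power_mono) auto
  then show "(mesh_size S)\<^sup>2 \<le> \<tau>\<^sup>2 * \<kappa>\<^sup>2 * (inradius (K_at S i c t))\<^sup>2"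
    by (simp add: power_mult_distrib mult_ac)
qed

text \<open>The area cancels the determinant in the divergence; what remains is continuous on the
  compact slab.\<close>

lemma bdd_above_cfl:
  assumes J: "\<And>t. t \<in> slab S n \<Longrightarrow> 0 < J_at S n c t"
  shows "bdd_above ((\<lambda>t. s * \<bar>div_velocity S n c t\<bar> * area_at S n c t + r) ` slab S n)"
proof -
  let ?g = "\<lambda>t. s * (\<bar>trace (adj2 (A_at S n c t) ** mesh_vel S n c)\<bar> / 2) + r"
  have "continuous_on (slab S n) ?g"
    unfolding trace_def matrix_matrix_mult_def
    by (auto intro!: continuous_intros continuous_on_adj2_A_at)
  then have "bdd_above (?g ` slab S n)"
    by (intro bounded_imp_bdd_above compact_imp_bounded compact_continuous_image)
      (simp_all add: slab_def)
  moreover have "?g ` slab S n = (\<lambda>t. s * \<bar>div_velocity S n c t\<bar> * area_at S n c t + r) ` slab S n"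
    using J by (intro image_cong) (simp_all add: area_at_J abs_mult less_imp_le flip: div_velocity_mult_J)
  ultimately show ?thesis by simp
qed

text \<open>The area of a cell strictly exceeds that of its inscribed disc, so the strict inequality
  holds although the CFL condition is not strict. Without strictness the stage areas could vanish.\<close>

lemma cfl_pointwise:
  assumes bd: "bounded (closure \<Omega>)" and A1: "A1 \<Omega> S" and A2: "A2 S" and A3: "A3 S \<kappa> \<tau>"
    and n: "n < nsteps S" and c: "c \<in> cells S" and t: "t \<in> slab S n" and dt: "0 \<le> step S n"
    and CFL: "(SUP t\<in>slab S n. sigma_hat k * \<bar>div_velocity S n c t\<bar> * area_at S n c t + r)
          * (step S n / (mesh_size S)\<^sup>2) \<le> pi * sigma_hat k / (\<tau>\<^sup>2 * \<kappa>\<^sup>2)"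
  shows "step S n * (sigma_hat k * \<bar>div_velocity S n c t\<bar> * area_at S n c t + r)
    < sigma_hat k * area_at S n c t"
proof -
  let ?X = "\<lambda>t. sigma_hat k * \<bar>div_velocity S n c t\<bar> * area_at S n c t + r"
  let ?h = "mesh_size S"
  have J: "0 < J_at S n c t" if "t \<in> slab S n" for t
    using A2 n c that unfolding A2_def by blast
  note h = mesh_size_inradius[OF bd A1 A2 A3 n c t]
  have \<kappa>\<tau>: "0 < \<kappa>" "0 < \<tau>"
    using A3 unfolding A3_def by simp_all
  have "?X t \<le> (SUP t\<in>slab S n. ?X t)"
    using t J by (intro cSUP_upper bdd_above_cfl)
  then have "?X t * (step S n / ?h\<^sup>2) \<le> pi * sigma_hat k / (\<tau>\<^sup>2 * \<kappa>\<^sup>2)"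
    using dt by (intro order.trans[OF mult_right_mono CFL]) auto
  then have "?X t * step S n \<le> pi * sigma_hat k / (\<tau>\<^sup>2 * \<kappa>\<^sup>2) * ?h\<^sup>2"
    using h(1) by (simp add: field_simps)
  \<comment> \<open>By (A3) the mesh size is at most \<open>\<tau> * \<kappa>\<close> times the
    inradius, so these constants cancel and the area of the inscribed disc remains.\<close>
  also have "\<dots> \<le> pi * sigma_hat k / (\<tau>\<^sup>2 * \<kappa>\<^sup>2) * (\<tau>\<^sup>2 * \<kappa>\<^sup>2 * (inradius (K_at S n c t))\<^sup>2)"
    using h(2) sigma_hat_pos[of k] \<kappa>\<tau> by (intro mult_left_mono) auto
  also have "\<dots> = sigma_hat k * (pi * (inradius (K_at S n c t))\<^sup>2)"
    using \<kappa>\<tau> by simp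
  also have "\<dots> < sigma_hat k * area_at S n c t"
    using area_gt_inradius[OF J[OF t]] sigma_hat_pos[of k] by simp
  finally show ?thesis
    by (simp add: mult.commute)
qed

section \<open>Assembly of the two Runge-Kutta stages\<close>

lemma L2_ref_one: "L2_ref q (\<lambda>_. 1) = cell_avg q / 2"
  by (simp add: L2_ref_def cell_avg_def measure_K_ref)

lemma moving_mesh_tlev:
  assumes mesh: "moving_mesh \<Omega> T S" and n: "n < nsteps S"
  shows "tlev S n < tlev S (Suc n)" and "tlev S (Suc n) \<in> {0..T}"
proof -
  have incr: "tlev S i < tlev S (Suc i)" if "i < nsteps S" for i
    using mesh that unfolding moving_mesh_def by blast
  then show "tlev S n < tlev S (Suc n)"
    using n by blast
  have mono: "tlev S i \<le> tlev S j" if "i \<le> j" "j \<le> nsteps S" for i j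
    using that
  proof (induction rule: dec_induct)
    case (step j)
    then show ?case using incr[of j] by simp
  qed simp
  show "tlev S (Suc n) \<in> {0..T}"
    using mono[of 0 "Suc n"] mono[of "Suc n" "nsteps S"] n mesh
    by (simp add: moving_mesh_def)
qed

theorem theorem4p7:
  fixes \<Omega> :: "(real^2) set" and T :: real
    and S :: "('v, 'c) mesh" and n :: nat and \<kappa> \<tau> :: real
    and f :: "real \<Rightarrow> real^2" and u_init :: "real^2 \<Rightarrow> real" and m M :: real
    and k :: nat and Q :: quad_rule and B :: "'c boundary_cond"
    and u0 u1 u1_lim u2 u2_lim :: "'c mesh_fun" and lam :: real
  assumes domain: "open_convex_polygon \<Omega>"
    and mesh: "moving_mesh \<Omega> T S" and n: "n < nsteps S"
    and A1: "A1 \<Omega> S" and A2: "A2 S" and A3: "A3 S \<kappa> \<tau>"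
    and f: "f C1_differentiable_on UNIV"
    and min: "m \<in> u_init ` \<Omega>" "\<forall>x\<in>\<Omega>. m \<le> u_init x"
    and max: "M \<in> u_init ` \<Omega>" "\<forall>x\<in>\<Omega>. u_init x \<le> M"
    and quad: "triangle_rule k Q"
    and bc: "admissible_bc S k Q T m M B"
    and lam: "lam = lf_lambda f S n m M"
    and u0_poly: "\<forall>c\<in>cells S. u0 c \<in> Pk k"
    and u0_int: "\<forall>c\<in>cells S. \<forall>\<gamma>\<in>{1..n_interior k}. u0 c (inode Q \<gamma>) \<in> {m..M}"
    and u0_edge_int: "\<forall>c\<in>cells S. interior_value Q u0 c \<in> M_set k m M"
    and u0_edge_ext: "\<forall>c\<in>cells S. exterior_value S Q B n (tlev S n) u0 c \<in> M_set k m M"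
    and CFL: "\<forall>c\<in>cells S.
        (SUP t\<in>slab S n. sigma_hat k * \<bar>div_velocity S n c t\<bar> * area_at S n c t
                          + (\<Sum>\<nu>\<in>UNIV. lam * ref_len \<nu>))
          * (step S n / (mesh_size S)\<^sup>2)
        \<le> pi * sigma_hat k / (\<tau>\<^sup>2 * \<kappa>\<^sup>2)"
    and stage1: "rk2_stage1 f S k Q B lam n u0 u1"
    and limit1: "\<forall>c\<in>cells S. u1_lim c = limiter k Q m M (u1 c)"
    and stage2: "rk2_stage2 f S k Q B lam n u0 u1_lim u2"
    and limit2: "\<forall>c\<in>cells S. u2_lim c = limiter k Q m M (u2 c)"
  shows "\<forall>c\<in>cells S. \<forall>\<xi>\<in>quad_nodes k Q. u2_lim c \<xi> \<in> {m..M}"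
proof
  fix c assume c: "c \<in> cells S"
  let ?t0 = "tlev S n" and ?t1 = "tlev S (Suc n)" and ?dt = "step S n" and ?s = "sigma_hat k"
  let ?L = "\<Sum>\<nu>\<in>UNIV. lam * ref_len \<nu>"
  note time = moving_mesh_tlev[OF mesh n]
  have dt: "0 \<le> ?dt"
    using time(1) by (simp add: step_def)
  have slab: "?t0 \<in> slab S n" "?t1 \<in> slab S n"
    using time(1) by (simp_all add: slab_def)
  have J: "0 < J_at S n c t" if "c \<in> cells S" "t \<in> slab S n" for c t
    using A2 n that unfolding A2_def by blast
  have fin: "finite (cells S)"
    using mesh unfolding moving_mesh_def regular_triangulation_def by blast
  have gauss: "gauss_rule k Q"
    using quad unfolding triangle_rule_def by blast
  have "m \<le> M"
    using min max by force
  \<comment> \<open>At the old level twice the area is the Jacobian, covered by the first set of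
    \<open>lf_lambda\<close>; the stage area is covered by the second.\<close>
  have speed0: "wave_speed f S n c (2 * area_at S n c ?t0) ?t0 \<nu> \<xi> u \<le> lam"
    and speed1: "wave_speed f S n c (2 * area_stage1 S n c) ?t1 \<nu> \<xi> u \<le> lam"
    if "c \<in> cells S" "\<xi> \<in> ref_edge \<nu>" "u \<in> {m..M}" for c \<nu> \<xi> u
    using wave_speed_le_lf_lambda[OF f fin J that] J[OF that(1)] slab
    by (auto simp: lam area_at_J less_imp_le)
  have "0 \<le> lam"
  proof -
    have "ref_vertex 1 \<in> ref_edge 1"
      by (simp add: ref_edge_def)
    moreover have "m \<in> {m..M}"
      using \<open>m \<le> M\<close> by simp
    ultimately have "wave_speed f S n c (2 * area_at S n c ?t0) ?t0 1 (ref_vertex 1) m \<le> lam"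
      by (rule speed0[OF c])
    then show ?thesis
      unfolding wave_speed_def by linarith
  qed
  then have edge: "lam * ref_len \<nu> \<le> ?L" for \<nu>
    by (intro member_le_sum) (auto simp: less_imp_le ref_len_pos)
  have CFL': "?dt * (?s * \<bar>div_velocity S n c t\<bar> * area_at S n c t + ?L) < ?s * area_at S n c t"
    if "c \<in> cells S" "t \<in> slab S n" for c t
    using CFL that(1)
    by (intro cfl_pointwise[OF bounded_open_convex_polygon[OF domain] A1 A2 A3 n that dt]) blast
  have area_pos: "0 < area_at S n c t" if "c \<in> cells S" "t \<in> slab S n" for c t
    using J[OF that] by (simp add: area_at_J)
  have cfl0: "?dt * (lam * ref_len \<nu>) \<le> ?s * area_at S n c ?t0"
    and cfl1: "?dt * (lam * ref_len \<nu>) \<le> ?s * area_stage1 S n c"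
    and stage1_pos: "0 < area_stage1 S n c" if "c \<in> cells S" for c \<nu>
  proof -
    let ?a = "area_at S n c ?t0" and ?d = "div_velocity S n c ?t0"
    have "?dt * ?L \<ge> 0"
      using dt \<open>0 \<le> lam\<close> by (intro mult_nonneg_nonneg sum_nonneg) (auto simp: less_imp_le ref_len_pos)
    have le: "?dt * (lam * ref_len \<nu>) \<le> ?dt * ?L"
      using edge dt by (rule mult_left_mono)
    have "0 \<le> ?s * (?dt * (\<bar>?d\<bar> * ?a))"
      using sigma_hat_pos[of k] dt area_pos[OF that slab(1)] by simp
    moreover have lt: "?s * (?dt * (\<bar>?d\<bar> * ?a)) + ?dt * ?L < ?s * ?a"
      using CFL'[OF that slab(1)] by (simp add: algebra_simps)
    ultimately show "?dt * (lam * ref_len \<nu>) \<le> ?s * ?a"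
      using le by linarith
    \<comment> \<open>The divergence term of the CFL condition bounds the area lost in the first
      stage, so the edge term still fits below the stage area.\<close>
    have "(- ?d) * ?a \<le> \<bar>?d\<bar> * ?a"
      using area_pos[OF that slab(1)] by (intro mult_right_mono) auto
    then have "?dt * ((- ?d) * ?a) \<le> ?dt * (\<bar>?d\<bar> * ?a)"
      using dt by (rule mult_left_mono)
    then have "?a - ?dt * (\<bar>?d\<bar> * ?a) \<le> area_stage1 S n c"
      by (simp add: area_stage1_def mult.assoc)
    then have "?s * (?a - ?dt * (\<bar>?d\<bar> * ?a)) \<le> ?s * area_stage1 S n c"
      using sigma_hat_pos[of k] by (intro mult_left_mono) auto
    with lt have gt: "?dt * ?L < ?s * area_stage1 S n c"
      by (simp add: right_diff_distrib)
    with le show "?dt * (lam * ref_len \<nu>) \<le> ?s * area_stage1 S n c"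
      by linarith
    have "0 < ?s * area_stage1 S n c"
      using gt \<open>?dt * ?L \<ge> 0\<close> by linarith
    then show "0 < area_stage1 S n c"
      using sigma_hat_pos[of k] by (simp add: zero_less_mult_iff)
  qed
  have u0_within: "u0 c \<xi> \<in> {m..M}" if "c \<in> cells S" "\<xi> \<in> quad_nodes k Q" for c \<xi>
    using that u0_int u0_edge_int by (auto simp: quad_nodes_def M_set_def interior_value_def)
  have u0_ext: "exterior_value S Q B n ?t0 u0 c \<nu> \<beta> \<in> {m..M}" if "c \<in> cells S" "\<beta> \<in> {1..k+1}" for c \<nu> \<beta>
    using that u0_edge_ext unfolding M_set_def by blast
  \<comment> \<open>The step size is left free: 0 gives the bound on the average of
    \<open>u0\<close>, and \<open>step S n\<close> gives the first stage.\<close>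
  have stage1_within: "area_at S n c ?t0 * cell_avg (u0 c)
      + dt * dg_rhs f S k Q B lam n c u0 (\<lambda>_. 1) (2 * area_at S n c ?t0) ?t0
    \<in> {m * (area_at S n c ?t0 + dt * div_velocity S n c ?t0 * area_at S n c ?t0)
       .. M * (area_at S n c ?t0 + dt * div_velocity S n c ?t0 * area_at S n c ?t0)}"
    if "c \<in> cells S" "0 \<le> dt" "\<And>\<nu>. dt * (lam * ref_len \<nu>) \<le> ?s * area_at S n c ?t0" for c dt
    using u0_poly u0_within u0_ext speed0 area_pos[OF that(1) slab(1)] that
    by (intro euler_step_within[OF f quad]) (auto simp del: atLeastAtMost_iff)
  have avg0: "cell_avg (u0 c) \<in> {m..M}"
    using stage1_within[OF c, of 0] area_pos[OF c slab(1)] sigma_hat_pos[of k] by simp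
  have avg1: "cell_avg (u1 c) \<in> {m..M}" if "c \<in> cells S" for c
  proof -
    have "2 * area_stage1 S n c * L2_ref (u1 c) (\<lambda>_. 1)
        = 2 * area_at S n c ?t0 * L2_ref (u0 c) (\<lambda>_. 1)
          + ?dt * dg_rhs f S k Q B lam n c u0 (\<lambda>_. 1) (2 * area_at S n c ?t0) ?t0"
      using stage1 that const_in_Pk[of 1 k] unfolding rk2_stage1_def by blast
    then have "area_stage1 S n c * cell_avg (u1 c) \<in> {m * area_stage1 S n c .. M * area_stage1 S n c}"
      using stage1_within[OF that dt cfl0[OF that]]
      by (simp add: L2_ref_one flip: area_stage1_def)
    then show ?thesis
      using stage1_pos[OF that] by (simp add: mult.commute)
  qed
  have lim_within: "nodes_within S k Q m M u1_lim"
    using limit1 limiter_within[OF avg1] unfolding nodes_within_def by simp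
  have lim_poly: "\<forall>c\<in>cells S. u1_lim c \<in> Pk k"
    using limit1 stage1 limiter_in_Pk unfolding rk2_stage1_def by metis
  have lim_ext: "exterior_value S Q B n ?t1 u1_lim c \<nu> \<beta> \<in> {m..M}" if \<beta>: "\<beta> \<in> {1..k+1}" for \<nu> \<beta>
    using bc time(2) lim_poly lim_within c \<beta>
    by (intro exterior_value_within[OF gauss J[OF _ slab(2)] lim_within c \<beta>])
      (auto simp: admissible_bc_def simp del: atLeastAtMost_iff)
  let ?a0 = "area_at S n c ?t0" and ?a1 = "area_stage1 S n c" and ?d = "div_velocity S n c ?t1"
  \<comment> \<open>\<open>E\<close> is an Euler step from the limited first stage. The second stage
    averages it with the old cell content, and the areas are averaged in the same way.\<close>
  define E where "E = ?a1 * cell_avg (u1_lim c)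
      + ?dt * dg_rhs f S k Q B lam n c u1_lim (\<lambda>_. 1) (2 * ?a1) ?t1"
  have E: "E \<in> {m * (?a1 + ?dt * ?d * ?a1) .. M * (?a1 + ?dt * ?d * ?a1)}"
    unfolding E_def
  proof (rule euler_step_within[OF f quad _ _ lim_ext speed1[OF c] _ dt cfl1[OF c]])
    show "u1_lim c \<in> Pk k"
      using lim_poly c by blast
    show "u1_lim c \<xi> \<in> {m..M}" if "\<xi> \<in> quad_nodes k Q" for \<xi>
      using lim_within c that unfolding nodes_within_def by blast
    show "0 \<le> ?a1"
      using stage1_pos[OF c] by simp
  qed
  have stage2_area: "area_stage2 S n c = 1/2 * ?a0 + 1/2 * (?a1 + ?dt * ?d * ?a1)"
    by (simp add: area_stage2_def algebra_simps)
  \<comment> \<open>The CFL condition at the new level, divided by the true cell area there, gives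
    \<open>?dt * \<bar>?d\<bar> < 1\<close>. The positive stage area is multiplied in
    afterwards.\<close>
  have "0 < 1 + ?dt * ?d"
  proof -
    let ?b = "area_at S n c ?t1"
    have "0 \<le> ?L"
      using \<open>0 \<le> lam\<close> by (intro sum_nonneg) (auto simp: less_imp_le ref_len_pos)
    then have "?dt * (?s * \<bar>?d\<bar> * ?b) \<le> ?dt * (?s * \<bar>?d\<bar> * ?b + ?L)"
      using dt by (intro mult_left_mono) auto
    also have "\<dots> < ?s * ?b"
      using CFL'[OF c slab(2)] .
    finally have "(?s * ?b) * (?dt * \<bar>?d\<bar>) < (?s * ?b) * 1"
      by (simp add: mult_ac)
    then have "?dt * \<bar>?d\<bar> < 1"
      using sigma_hat_pos[of k] area_pos[OF c slab(2)] by (simp add: mult_less_cancel_left_pos)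
    moreover have "\<bar>?dt * ?d\<bar> = ?dt * \<bar>?d\<bar>"
      using dt by (simp add: abs_mult)
    ultimately show ?thesis by linarith
  qed
  then have "0 < ?a1 * (1 + ?dt * ?d)"
    using stage1_pos[OF c] by simp
  then have pos2: "0 < area_stage2 S n c"
    using area_pos[OF c slab(1)] by (simp add: stage2_area algebra_simps)
  have "2 * area_stage2 S n c * L2_ref (u2 c) (\<lambda>_. 1)
      = 1/2 * (2 * ?a0) * L2_ref (u0 c) (\<lambda>_. 1) + 1/2 * (2 * ?a1) * L2_ref (u1_lim c) (\<lambda>_. 1)
        + ?dt / 2 * dg_rhs f S k Q B lam n c u1_lim (\<lambda>_. 1) (2 * ?a1) ?t1"
    using stage2 c const_in_Pk[of 1 k] unfolding rk2_stage2_def by blast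
  then have avg2: "area_stage2 S n c * cell_avg (u2 c) = 1/2 * (?a0 * cell_avg (u0 c)) + 1/2 * E"
    by (simp add: L2_ref_one E_def algebra_simps)
  have "?a0 * cell_avg (u0 c) \<in> {m * ?a0 .. M * ?a0}"
    using avg0 area_pos[OF c slab(1)] by (simp add: mult.commute)
  then have "area_stage2 S n c * cell_avg (u2 c) \<in> {m * area_stage2 S n c .. M * area_stage2 S n c}"
    using E unfolding avg2 unfolding stage2_area distrib_left by simp
  then have "cell_avg (u2 c) \<in> {m..M}"
    using pos2 by (simp add: mult.commute)
  then show "\<forall>\<xi>\<in>quad_nodes k Q. u2_lim c \<xi> \<in> {m..M}"
    using limit2 c limiter_within by simp
qed

end
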